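(* Let $D\ge2$ be an integer, $E_0,\ldots,E_D\in\mathbb{R}$ and $\beta\in\mathbb{R}$. The process $(X_n)_{n=0}^\infty$ of levels of the random tree with distribution $P_\infty$ is Markov with transition probability, for levels $g,g'$, $$\mathsf{P}\{X_{n+1}=g'\mid X_n=g\}=\begin{cases}\dfrac{|g'|}{|g|}\,e^{-\beta E(g,g')}\rho^{|g'|-|g|}\sigma^{|g|}, & g\lhd g',\\[2mm] 0,&\text{otherwise.}\end{cases}$$
   Context: Trees. $\mathbb{N}=\{1,2,\ldots\}$, $\mathbb{Z}_+=\mathbb{N}\cup\{0\}$. A plane tree is a rooted tree in which the child subtrees of every vertex are linearly ordered (up to isomorphism preserving the root and these orders). The branching number $\deg(v)$ is the number of children of $v$; the height of $v$ is its distance to the root; the height of a finite tree is the maximal height of its vertices. $\mathbb{T}_N$ is the set of plane trees on $N$ vertices with all branching numbers at most $D$; $\mu_N\{T\}=e^{-\beta E(T)}/Z_N$ for $T\in\mathbb{T}_N$, with $E(T)=\sum_{v\in V(T)}E_{\deg(v)}$ ($V(T)$ being the vertex set) and $Z_N=\sum_{T\in\mathbb{T}_N}e^{-\beta E(T)}$. $\pi_n T$ is the subtree of $T$ spanned by all vertices of height at most $n$. $S_n$ is the set of plane trees of height exactly $n$ with all branching numbers at most $D$. $P_n$ is the probability measure on $S_n$ that is the limit in total variation, as $N\to\infty$, of the push-forwards of $\mu_N$ under $\pi_n$ (this limit exists). $P_\infty$ is the unique probability measure on the space of all (finite or infinite) plane trees with branching numbers at most $D$ whose push-forward under $\pi_n$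 is $P_n$ for every $n\in\mathbb{N}$; it is concentrated on infinite trees. Parameters. Let $\Delta=\{p\in[0,1]^{D+1}:\ \sum_{i=0}^D p_i=1,\ \sum_{i=0}^D i p_i=1\}$ and $J(p)=\sum_{i=0}^D p_i\ln p_i+\beta\sum_{i=0}^D p_iE_i$ (with $0\ln0=0$). $J$ has a unique minimizer $p^*$ on $\Delta$, of the form $p_i^*=Ce^{-\beta E_i}\rho^i$, where $\rho>0$ is the unique positive solution of $\sum_{i=0}^D e^{-\beta E_i}\rho^i=\sum_{i=0}^D i e^{-\beta E_i}\rho^i$ and $1/C=\sum_{i=0}^De^{-\beta E_i}\rho^i$. $\sigma=e^{J(p^* )}$. Levels and the process $(X_n)$. The vertices of height $n$ of a tree (the $n$-th level) are naturally ordered and enumerated by $1,\ldots,r_n$. For $n\ge1$ the $n$-th level is encoded by the sequence $g_n=(g_{n,l})_{l\in\mathbb{N}}\in\mathbb{Z}_+^{\mathbb{N}}$, where $g_{n,l}$ is the number of the parent (in the enumeration of level $n-1$) of the $l$-th vertex of level $n$ if $l\le r_n$, and $g_{n,l}=0$ if $l>r_n$; the zeroth level is $g_0=(1,0,0,\ldots)$. $X_n$ is the $\mathbb{Z}_+^{\mathbb{N}}$-valued random variable equal to the encoding $g_n$ of the $n$-th level of the random tree with distribution $P_\infty$. A level is a sequence $g:\mathbb{N}\to\mathbb{Z}_+$ that can arise as such an encoding of a level of a plane tree with branching numbers at most $D$: its nonzero entries come first and are nondecreasing, each positive value occurs at most $D$ times, and they are followed by zeros. $|g|$ is the number of nonzero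 entries of $g$. For levels $g,g'$ write $g\lhd g'$ if $\max_l g'_l\le|g|$; in that case $E(g,g')=\sum_{i=1}^{|g|}E_{\#\{j:\ g'_j=i\}}$. As usual, the formula for the conditional probability is for $g$ with $\mathsf{P}\{X_n=g\}>0$. *)

theory Defs
  imports "HOL-Probability.Probability" "HOL-Library.List_Lexorder"
begin

(* Plane trees are taken in Ulam-Harris form: a vertex is the word of child indices (counted
   from 0) leading to it from the root [], so its height is its length. Since all branching
   numbers are finite, this picks exactly one representative from each isomorphism class. *)

definition plane_trees :: "nat \<Rightarrow> nat list set set" where
  "plane_trees D = {T. [] \<in> T \<and> (\<forall>v i. v @ [i] \<in> T \<longrightarrow> v \<in> T) \<and>
     (\<forall>v\<in>T. \<exists>k\<le>D. {i. v @ [i] \<in> T} = {..<k})}"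

definition branching :: "nat list set \<Rightarrow> nat list \<Rightarrow> nat" where
  "branching T v = card {i. v @ [i] \<in> T}"

definition trees_size :: "nat \<Rightarrow> nat \<Rightarrow> nat list set set" where
  "trees_size D N = {T \<in> plane_trees D. finite T \<and> card T = N}"

definition trees_height :: "nat \<Rightarrow> nat \<Rightarrow> nat list set set" where
  "trees_height D n = {T \<in> plane_trees D. finite T \<and> Max (length ` T) = n}"

definition trunc :: "nat \<Rightarrow> nat list set \<Rightarrow> nat list set" where
  "trunc n T = {v \<in> T. length v \<le> n}"

definition tree_energy :: "(nat \<Rightarrow> real) \<Rightarrow> nat list set \<Rightarrow> real" where
  "tree_energy E T = (\<Sum>v\<in>T. E (branching T v))"

definition partition_fun :: "nat \<Rightarrow> (nat \<Rightarrow> real) \<Rightarrow> real \<Rightarrow> nat \<Rightarrow> real" where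
  "partition_fun D E \<beta> N = (\<Sum>T\<in>trees_size D N. exp (- \<beta> * tree_energy E T))"

definition gibbs :: "nat \<Rightarrow> (nat \<Rightarrow> real) \<Rightarrow> real \<Rightarrow> nat \<Rightarrow> nat list set measure" where
  "gibbs D E \<beta> N = point_measure (trees_size D N)
     (\<lambda>T. ennreal (exp (- \<beta> * tree_energy E T) / partition_fun D E \<beta> N))"

definition total_variation :: "'a measure \<Rightarrow> 'a measure \<Rightarrow> real" where
  "total_variation \<mu> \<nu> = (SUP A\<in>sets \<mu>. \<bar>measure \<mu> A - measure \<nu> A\<bar>)"

(* "Q is the measure P_n". A small tree has height below n, so the push-forward of the Gibbs
   measure may charge trees outside the support of Q; both are compared on all sets. *)
definition is_P :: "nat \<Rightarrow> (nat \<Rightarrow> real) \<Rightarrow> real \<Rightarrow> nat \<Rightarrow> nat list set pmf \<Rightarrow> bool" where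
  "is_P D E \<beta> n Q \<longleftrightarrow> set_pmf Q \<subseteq> trees_height D n \<and>
     (\<lambda>N. total_variation (distr (gibbs D E \<beta> N) (count_space UNIV) (trunc n)) (measure_pmf Q))
       \<longlonglongrightarrow> 0"

definition tree_space :: "nat \<Rightarrow> nat list set measure" where
  "tree_space D = sigma (plane_trees D) {{T \<in> plane_trees D. trunc n T = S} | n S. True}"

(* "M is the measure P_infinity", where P n is the measure P_n. *)
definition is_P_infty :: "nat \<Rightarrow> (nat \<Rightarrow> nat list set pmf) \<Rightarrow> nat list set measure \<Rightarrow> bool" where
  "is_P_infty D P M \<longleftrightarrow> prob_space M \<and> space M = plane_trees D \<and> sets M = sets (tree_space D) \<and>
     (\<forall>n\<ge>1. distr M (count_space UNIV) (trunc n) = measure_pmf (P n))"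

definition mean_one_laws :: "nat \<Rightarrow> (nat \<Rightarrow> real) set" where
  "mean_one_laws D = {p \<in> {..D} \<rightarrow>\<^sub>E {0..1}. (\<Sum>i\<le>D. p i) = 1 \<and> (\<Sum>i\<le>D. real i * p i) = 1}"

(* The convention 0 ln 0 = 0 holds for the total function ln. *)
definition J :: "nat \<Rightarrow> (nat \<Rightarrow> real) \<Rightarrow> real \<Rightarrow> (nat \<Rightarrow> real) \<Rightarrow> real" where
  "J D E \<beta> p = (\<Sum>i\<le>D. p i * ln (p i)) + \<beta> * (\<Sum>i\<le>D. p i * E i)"

definition sigma_const :: "nat \<Rightarrow> (nat \<Rightarrow> real) \<Rightarrow> real \<Rightarrow> real" where
  "sigma_const D E \<beta> = exp (J D E \<beta> (arg_min_on (J D E \<beta>) (mean_one_laws D)))"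

definition rho :: "nat \<Rightarrow> (nat \<Rightarrow> real) \<Rightarrow> real \<Rightarrow> real" where
  "rho D E \<beta> = (THE r. 0 < r \<and>
     (\<Sum>i\<le>D. exp (- \<beta> * E i) * r ^ i) = (\<Sum>i\<le>D. real i * exp (- \<beta> * E i) * r ^ i))"

definition level_vertices :: "nat list set \<Rightarrow> nat \<Rightarrow> nat list set" where
  "level_vertices T n = {v \<in> T. length v = n}"

(* The order on words of a fixed length is the lexicographic one; the numbering starts at 1. *)
definition vertex_number :: "nat list set \<Rightarrow> nat list \<Rightarrow> nat" where
  "vertex_number T v = card {u \<in> level_vertices T (length v). u \<le> v}"

(* A sequence indexed by the positive integers is a function on nat shifted by one place:
   the entry with index l is the value at l - 1. The entries themselves are not shifted, so 0
   still means that there is no such vertex. *)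
definition level_code :: "nat \<Rightarrow> nat list set \<Rightarrow> nat \<Rightarrow> nat" where
  "level_code n T l =
     (if n = 0 then (if l = 0 then 1 else 0)
      else (let vs = sorted_list_of_set (level_vertices T n)
            in if l < length vs then vertex_number T (butlast (vs ! l)) else 0))"

definition levels :: "nat \<Rightarrow> (nat \<Rightarrow> nat) set" where
  "levels D = {g. \<exists>r. (\<forall>l. g l \<noteq> 0 \<longleftrightarrow> l < r) \<and> mono_on {..<r} g \<and>
     (\<forall>i>0. card {l. g l = i} \<le> D)}"

definition level_size :: "(nat \<Rightarrow> nat) \<Rightarrow> nat" where
  "level_size g = card {l. g l \<noteq> 0}"

definition level_follows :: "(nat \<Rightarrow> nat) \<Rightarrow> (nat \<Rightarrow> nat) \<Rightarrow> bool" (infix \<open>\<lhd>\<^sub>l\<close> 50) where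
  "g \<lhd>\<^sub>l g' \<longleftrightarrow> (\<forall>l. g' l \<le> level_size g)"

definition level_energy :: "(nat \<Rightarrow> real) \<Rightarrow> (nat \<Rightarrow> nat) \<Rightarrow> (nat \<Rightarrow> nat) \<Rightarrow> real" where
  "level_energy E g g' = (\<Sum>i=1..level_size g. E (card {j. g' j = i}))"

(* The Markov property of a process taking at most countably many values, stated with
   elementary conditional probabilities given the whole past. *)
definition markov_chain :: "'a measure \<Rightarrow> (nat \<Rightarrow> 'a \<Rightarrow> 's) \<Rightarrow> bool" where
  "markov_chain M X \<longleftrightarrow> (\<forall>n. X n \<in> M \<rightarrow>\<^sub>M count_space UNIV) \<and>
     (\<forall>n x y. \<P>(\<omega> in M. \<forall>k\<le>n. X k \<omega> = x k) > 0 \<longrightarrow>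
        \<P>(\<omega> in M. X (Suc n) \<omega> = y \<bar> \<forall>k\<le>n. X k \<omega> = x k) =
        \<P>(\<omega> in M. X (Suc n) \<omega> = y \<bar> X n \<omega> = x n))"

end

theory Submission
  imports Defs
begin

text \<open>
  With \<open>w i = exp (- \<beta> * E i)\<close> and \<open>\<phi> = (\<Sum>i\<le>D. w i * \<rho> ^ i)\<close>, the minimizer of \<open>J\<close> is the
  critical offspring law \<open>p i = w i * \<rho> ^ i / \<phi>\<close>, and \<open>\<sigma> = \<rho> / \<phi>\<close>. A tree of size \<open>N\<close> with
  truncation \<open>S\<close> at height \<open>n\<close> consists of \<open>S\<close> and a forest rooted at the \<open>r\<close> vertices of height
  \<open>n\<close>, so its Gibbs probability is the weight of \<open>S\<close> times a ratio of forest weights, which after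
  tilting to \<open>p\<close> has the form \<open>F r N / F 1 (N + m)\<close>.

  These ratios tend to \<open>r\<close>. No local limit theorem is needed for this, because the existence of
  \<open>P\<^sub>1\<close> already says that they converge for \<open>m = 1\<close> and \<open>1 \<le> r \<le> D\<close>. The limit for \<open>r = 1\<close> is the
  radius of convergence of the generating function \<open>Z\<close> with \<open>Z = x * (\<Sum>i\<le>D. p i * Z ^ i)\<close>, which is
  \<open>1\<close> because \<open>p\<close> is critical. The others are bounded below by \<open>r\<close> (Fatou), and averaging over the
  offspring of the root forces equality; the recursion of the forest weights then extends this to
  all \<open>r\<close>.

  Hence the truncation of the infinite tree equals \<open>S\<close> with probability \<open>r * \<rho> ^ (r - 1) * \<sigma> ^ m\<close>
  times the weight of the \<open>m\<close> vertices of \<open>S\<close> of height less than \<open>n\<close>. The levels up to \<open>n\<close>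
  determine \<open>S\<close>, so the transition probabilities are quotients of two such expressions, in which
  everything but the last two levels cancels.
\<close>

section \<open>Forest weights\<close>

text \<open>The total weight of the ordered forests of \<open>r\<close> trees with \<open>k\<close> vertices: removing the root of
  the first tree leaves its \<open>i\<close> subtrees in front of the other \<open>r - 1\<close> trees.\<close>

fun forest_weight :: "nat \<Rightarrow> (nat \<Rightarrow> real) \<Rightarrow> nat \<Rightarrow> nat \<Rightarrow> real" where
  "forest_weight D w r 0 = (if r = 0 then 1 else 0)"
| "forest_weight D w 0 (Suc k) = 0"
| "forest_weight D w (Suc r) (Suc k) = (\<Sum>i\<le>D. w i * forest_weight D w (r + i) k)"

declare forest_weight.simps(3) [simp del]

lemma forest_weight_0: "forest_weight D w 0 k = (if k = 0 then 1 else 0)"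
  by (cases k) auto

lemma forest_weight_nonneg:
  assumes "\<And>i. w i \<ge> 0"
  shows "forest_weight D w r k \<ge> 0"
proof (induction k arbitrary: r)
  case (Suc k)
  then show ?case
    by (cases r) (auto simp: forest_weight.simps(3) intro!: sum_nonneg mult_nonneg_nonneg assms)
qed auto

text \<open>Cut the forest after its first \<open>r\<close> trees, \<open>j\<close> being the number
  of vertices in front of the cut. The induction removes the root of the first tree, which lies in
  front unless \<open>r = 0\<close>.\<close>

lemma forest_weight_add:
  "forest_weight D w (r + s) k = (\<Sum>j\<le>k. forest_weight D w r j * forest_weight D w s (k - j))"
proof (induction k arbitrary: r s)
  case (Suc k)
  show ?case
  proof (cases r)
    case 0
    then show ?thesis by (subst sum.atMost_Suc_shift) (simp add: forest_weight_0)
  next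
    case (Suc r')
    have "forest_weight D w (r + s) (Suc k) = (\<Sum>i\<le>D. w i * forest_weight D w ((r' + i) + s) k)"
      by (simp add: Suc forest_weight.simps(3) ac_simps)
    also have "\<dots> = (\<Sum>i\<le>D. \<Sum>j\<le>k. w i * (forest_weight D w (r' + i) j * forest_weight D w s (k - j)))"
      by (simp only: Suc.IH sum_distrib_left)
    also have "\<dots> = (\<Sum>j\<le>k. \<Sum>i\<le>D. w i * (forest_weight D w (r' + i) j * forest_weight D w s (k - j)))"
      by (rule sum.swap)
    also have "\<dots> = (\<Sum>j\<le>k. forest_weight D w r (Suc j) * forest_weight D w s (k - j))"
      by (simp add: Suc forest_weight.simps(3) sum_distrib_right mult.assoc)
    \<comment> \<open>The added term \<open>j = 0\<close> vanishes because
      \<open>r > 0\<close>.\<close>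
    also have "\<dots> = (\<Sum>j\<le>Suc k. forest_weight D w r j * forest_weight D w s (Suc k - j))"
      unfolding sum.atMost_Suc_shift[of _ k] by (simp add: Suc)
    finally show ?thesis .
  qed
qed auto

text \<open>Tilting the weights changes the weight of a forest by a factor that depends only on the
  numbers of trees and vertices, because a forest of \<open>r\<close> trees with \<open>k\<close> vertices has \<open>k - r\<close> edges.\<close>

lemma forest_weight_tilt:
  assumes "a \<noteq> 0" "b \<noteq> 0"
  shows "forest_weight D (\<lambda>i. w i * a ^ i * b / a) r k = forest_weight D w r k * b ^ k / a ^ r"
proof (induction k arbitrary: r)
  case (Suc k)
  show ?case
  proof (cases r)
    case (Suc r')
    have "w i * a ^ i * b / a * (forest_weight D w (r' + i) k * b ^ k / a ^ (r' + i))
        = w i * forest_weight D w (r' + i) k * (b ^ Suc k / a ^ r)" for i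
      using Suc assms by (simp add: power_add)
    then show ?thesis
      using assms by (simp add: Suc forest_weight.simps(3) Suc.IH sum_distrib_right
          sum_divide_distrib)
  qed auto
qed auto

text \<open>By \<open>forest_weight_add\<close>, adding a tree multiplies the generating function by
  that of one tree. Nonnegative terms give the absolute convergence that the Cauchy product asks
  for.\<close>

lemma forest_weight_sums:
  fixes x :: real
  assumes "\<And>i. w i \<ge> 0" "x \<ge> 0" "summable (\<lambda>k. forest_weight D w 1 k * x ^ k)"
  shows "(\<lambda>k. forest_weight D w r k * x ^ k) sums (\<Sum>k. forest_weight D w 1 k * x ^ k) ^ r"
proof (induction r)
  case 0
  have "(\<lambda>k. forest_weight D w 0 k * x ^ k) = (\<lambda>k. if k = 0 then 1 else 0)"
    by (auto simp: forest_weight_0)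
  then show ?case using sums_single[of 0 "\<lambda>_. 1::real"] by simp
next
  case (Suc r)
  define Z where "Z = (\<Sum>k. forest_weight D w 1 k * x ^ k)"
  have nn: "\<And>r k. forest_weight D w r k * x ^ k \<ge> 0"
    using assms by (simp add: forest_weight_nonneg)
  have "(\<lambda>k. \<Sum>i\<le>k. (forest_weight D w 1 i * x ^ i) * (forest_weight D w r (k - i) * x ^ (k - i)))
      sums (Z * (\<Sum>k. forest_weight D w r k * x ^ k))"
    unfolding Z_def using assms(3) sums_summable[OF Suc] nn
    by (intro Cauchy_product_sums) (auto simp: abs_of_nonneg)
  moreover have "(\<Sum>k. forest_weight D w r k * x ^ k) = Z ^ r"
    using Suc sums_unique unfolding Z_def by metis
  moreover have "(\<Sum>i\<le>k. (forest_weight D w 1 i * x ^ i) * (forest_weight D w r (k - i)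
      * x ^ (k - i)))
      = forest_weight D w (Suc r) k * x ^ k" for k
  proof -
    have "(forest_weight D w 1 i * x ^ i) * (forest_weight D w r (k - i) * x ^ (k - i))
       = forest_weight D w 1 i * forest_weight D w r (k - i) * x ^ k" if "i \<le> k" for i
    proof -
      have "x ^ k = x ^ i * x ^ (k - i)" using that by (simp flip: power_add)
      then show ?thesis by simp
    qed
    then have "(\<Sum>i\<le>k. (forest_weight D w 1 i * x ^ i) * (forest_weight D w r (k - i) * x ^ (k - i)))
      = (\<Sum>i\<le>k. forest_weight D w 1 i * forest_weight D w r (k - i) * x ^ k)"
      by (intro sum.cong) auto
    then show ?thesis
      using forest_weight_add[of D w 1 r k] by (simp add: sum_distrib_right)
  qed
  ultimately show ?case unfolding Z_def by simp
qed

text \<open>Removing the root, which accounts for the factor \<open>x\<close>, leaves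
  \<open>i\<close> trees with generating function \<open>Z ^ i\<close>.\<close>

lemma forest_weight_root_decomposition:
  fixes x :: real
  assumes "\<And>i. w i \<ge> 0" "x \<ge> 0" "summable (\<lambda>k. forest_weight D w 1 k * x ^ k)"
  defines "Z \<equiv> (\<Sum>k. forest_weight D w 1 k * x ^ k)"
  shows "Z = x * (\<Sum>i\<le>D. w i * Z ^ i)"
proof -
  have "(\<lambda>k. \<Sum>i\<le>D. w i * (forest_weight D w i k * x ^ k)) sums (\<Sum>i\<le>D. w i * Z ^ i)"
    unfolding Z_def by (intro sums_sum sums_mult forest_weight_sums assms)
  then have "(\<lambda>k. x * (\<Sum>i\<le>D. w i * (forest_weight D w i k * x ^ k))) sums (x * (\<Sum>i\<le>D. w i * Z ^ i))"
    by (rule sums_mult)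
  moreover have "x * (\<Sum>i\<le>D. w i * (forest_weight D w i k * x ^ k))
      = forest_weight D w 1 (Suc k) * x ^ Suc k" for k
    by (simp add: forest_weight.simps(3) sum_distrib_left sum_distrib_right mult_ac)
  ultimately have "(\<lambda>k. forest_weight D w 1 (Suc k) * x ^ Suc k) sums (x * (\<Sum>i\<le>D. w i * Z ^ i))"
    by simp
  \<comment> \<open>No tree is without vertices, so dropping the coefficient at 0 keeps the
    sum.\<close>
  moreover have "(\<lambda>k. forest_weight D w 1 (Suc k) * x ^ Suc k) sums Z"
    using sums_Suc_iff[of "\<lambda>k. forest_weight D w 1 k * x ^ k" Z] assms(3)
    by (simp add: Z_def summable_sums)
  ultimately show ?thesis using sums_unique2 by blast
qed

section \<open>Critical Galton-Watson forests\<close>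

locale critical_offspring =
  fixes D :: nat and p :: "nat \<Rightarrow> real"
  assumes D_ge_2: "D \<ge> 2" and p_pos: "\<And>i. p i > 0"
    and p_sum: "(\<Sum>i\<le>D. p i) = 1" and p_mean: "(\<Sum>i\<le>D. real i * p i) = 1"
begin

text \<open>The probability that \<open>r\<close> independent Galton-Watson trees with offspring law
  \<open>p\<close> have \<open>k\<close> vertices in total.\<close>

abbreviation F :: "nat \<Rightarrow> nat \<Rightarrow> real" where "F \<equiv> forest_weight D p"

lemma F_nonneg: "F r k \<ge> 0"
  using forest_weight_nonneg less_imp_le[OF p_pos] by blast

text \<open>Witnessed by the path: start from a leaf and keep adding a root with a single
  child.\<close>

lemma F_1_pos: "F 1 (Suc k) > 0"
proof (induction k)
  case 0
  have "(\<Sum>i\<le>D. p i * F i 0) \<ge> p 0 * F 0 0"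
    using p_pos F_nonneg by (intro member_le_sum) (auto simp: less_imp_le)
  then show ?case using p_pos[of 0] by (simp add: forest_weight.simps(3))
next
  case (Suc k)
  have "p 1 * F 1 (Suc k) \<le> (\<Sum>i\<le>D. p i * F i (Suc k))"
    using D_ge_2 p_pos F_nonneg
    by (intro member_le_sum) (auto simp: less_imp_le)
  moreover have "F 1 (Suc (Suc k)) = (\<Sum>i\<le>D. p i * F i (Suc k))"
    by (simp add: forest_weight.simps(3))
  moreover have "p 1 * F 1 (Suc k) > 0" using Suc p_pos[of 1] by simp
  ultimately show ?case by linarith
qed

text \<open>Removing the first root turns the claim for \<open>Suc K\<close> into a
  \<open>p\<close>-average of claims for \<open>K\<close>. The bound supplies summability.\<close>

lemma F_partial_sums_le_1: "(\<Sum>k\<le>K. F r k) \<le> 1"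
proof (induction K arbitrary: r)
  case (Suc K)
  show ?case
  proof (cases r)
    case 0
    then show ?thesis by (simp add: forest_weight_0)
  next
    case (Suc r')
    have "(\<Sum>k\<le>Suc K. F r k) = (\<Sum>k\<le>K. \<Sum>i\<le>D. p i * F (r' + i) k)"
      by (subst sum.atMost_Suc_shift) (simp add: Suc forest_weight.simps(3))
    also have "\<dots> = (\<Sum>i\<le>D. p i * (\<Sum>k\<le>K. F (r' + i) k))"
      by (subst sum.swap) (simp add: sum_distrib_left)
    also have "\<dots> \<le> (\<Sum>i\<le>D. p i * 1)"
      by (intro sum_mono mult_left_mono Suc.IH less_imp_le[OF p_pos])
    finally show ?thesis by (simp add: p_sum)
  qed
qed auto

text \<open>Bernoulli's inequality bounds \<open>z ^ i\<close> by its tangent at 1, and by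
  criticality the tangents average to \<open>z\<close>. The term \<open>i = 2\<close> is kept exact,
  which makes 1 the only nonnegative fixed point.\<close>

lemma offspring_gf_ge:
  assumes "z \<ge> 0"
  shows "(\<Sum>i\<le>D. p i * z ^ i) \<ge> z + p 2 * (z - 1)\<^sup>2"
proof -
  have "z + p 2 * (z - 1)\<^sup>2 = (\<Sum>i\<le>D. p i * (1 + real i * (z - 1)) + (if i
      = 2 then p 2 * (z - 1)\<^sup>2 else 0))"
  proof -
    have "(\<Sum>i\<le>D. p i * (1 + real i * (z - 1))) = (\<Sum>i\<le>D. p i) + (z - 1) * (\<Sum>i\<le>D. real i * p i)"
      by (simp add: sum.distrib sum_distrib_left distrib_left mult_ac)
    then show ?thesis using D_ge_2 by (simp add: sum.distrib p_sum p_mean)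
  qed
  also have "\<dots> \<le> (\<Sum>i\<le>D. p i * z ^ i)"
  proof (intro sum_mono)
    fix i
    show "p i * (1 + real i * (z - 1)) + (if i = 2 then p 2 * (z - 1)\<^sup>2 else 0) \<le> p i * z ^ i"
    proof (cases "i = 2")
      case True
      then show ?thesis by (simp add: power2_eq_square algebra_simps)
    next
      case False
      have "1 + real i * (z - 1) \<le> (1 + (z - 1)) ^ i"
        using assms by (intro Bernoulli_inequality) auto
      then show ?thesis using False p_pos[of i] by simp
    qed
  qed
  finally show ?thesis .
qed

lemma F_summable: "summable (F r)"
  by (rule bounded_imp_summable[OF _ F_partial_sums_le_1]) (rule F_nonneg)

text \<open>The total mass is a nonnegative fixed point of the offspring generating function, and
  \<open>offspring_gf_ge\<close> leaves only 1: the critical tree is almost surely finite.\<close>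

lemma F_1_suminf: "(\<Sum>k. F 1 k) = 1"
proof -
  define s where "s = (\<Sum>k. F 1 k)"
  have "s = (\<Sum>i\<le>D. p i * s ^ i)"
    using forest_weight_root_decomposition[of p 1 D] F_summable[of 1] less_imp_le[OF p_pos]
    by (simp add: s_def)
  moreover have "s \<ge> 0" unfolding s_def using F_summable F_nonneg by (intro suminf_nonneg) auto
  ultimately have "p 2 * (s - 1)\<^sup>2 \<le> 0" using offspring_gf_ge[of s] by linarith
  then have "(s - 1)\<^sup>2 \<le> 0" using p_pos[of 2] by (simp add: mult_le_0_iff)
  then show ?thesis by (simp add: s_def)
qed

lemma F_sums_1: "F r sums 1"
  using forest_weight_sums[of p 1 D r] F_summable[of 1] less_imp_le[OF p_pos] F_1_suminf by simp

text \<open>A limit above 1 would let the generating function converge at some \<open>x > 1\<close>,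
  where its functional equation contradicts \<open>offspring_gf_ge\<close>. A limit below 1 would
  make \<open>F 1\<close> eventually nondecreasing, against summability.\<close>

lemma ratio_limit_eq_1:
  assumes lim: "(\<lambda>N. F 1 N / F 1 (Suc N)) \<longlonglongrightarrow> l"
  shows "l = 1"
proof (rule antisym)
  show "l \<le> 1"
  proof (rule ccontr)
    assume "\<not> l \<le> 1"
    then obtain y where y: "1 < y" "y < l" using dense by (metis not_le)
    \<comment> \<open>Eventually the ratios exceed \<open>y\<close>, so at a point \<open>x\<close>
      below \<open>y\<close> the ratio test applies with \<open>x / y < 1\<close>.\<close>
    obtain x where x: "1 < x" "x < y" using dense y by blast
    have "eventually (\<lambda>N. F 1 N / F 1 (Suc N) > y) sequentially"
      using order_tendstoD(1)[OF lim y(2)] .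
    then obtain N0 where N0: "\<And>N. N \<ge> N0 \<Longrightarrow> F 1 N / F 1 (Suc N) > y"
      by (auto simp: eventually_sequentially)
    have "summable (\<lambda>k. F 1 k * x ^ k)"
    proof (rule summable_ratio_test)
      show "x / y < 1" using x y by simp
      fix n assume "n \<ge> N0"
      then have "F 1 n > y * F 1 (Suc n)" using N0[of n] F_1_pos[of n] by (simp add: field_simps)
      then have "F 1 (Suc n) \<le> F 1 n / y" using y by (simp add: field_simps)
      then have "F 1 (Suc n) * x ^ Suc n \<le> F 1 n / y * x ^ Suc n"
        using x by (intro mult_right_mono) auto
      then show "norm (F 1 (Suc n) * x ^ Suc n) \<le> x / y * norm (F 1 n * x ^ n)"
        using x F_nonneg[of 1 n] F_nonneg[of 1 "Suc n"] by (simp add: abs_mult mult_ac)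
    qed
    define Z where "Z = (\<Sum>k. F 1 k * x ^ k)"
    have Z: "Z = x * (\<Sum>i\<le>D. p i * Z ^ i)"
      unfolding Z_def using x less_imp_le[OF p_pos] \<open>summable _\<close>
      by (intro forest_weight_root_decomposition) auto
    have "Z > 0" unfolding Z_def
      using \<open>summable _\<close> F_1_pos[of 0] F_nonneg x
      by (intro suminf_pos2[where i = 1]) auto
    have "x * Z \<le> x * (\<Sum>i\<le>D. p i * Z ^ i)"
    proof (rule mult_left_mono)
      have "0 \<le> p 2 * (Z - 1)\<^sup>2" using p_pos[of 2] by simp
      then show "Z \<le> (\<Sum>i\<le>D. p i * Z ^ i)" using offspring_gf_ge[of Z] \<open>Z > 0\<close> by linarith
    qed (use x in simp)
    then have "x * Z \<le> Z" using Z by simp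
    then show False using \<open>Z > 0\<close> x by simp
  qed
  show "l \<ge> 1"
  proof (rule ccontr)
    assume "\<not> l \<ge> 1"
    then have "eventually (\<lambda>N. F 1 N / F 1 (Suc N) < 1) sequentially"
      using order_tendstoD(2)[OF lim, of 1] by simp
    then obtain N0 where N0: "\<And>N. N \<ge> N0 \<Longrightarrow> F 1 N / F 1 (Suc N) < 1"
      by (auto simp: eventually_sequentially)
    have inc: "F 1 N \<le> F 1 (Suc N)" if "N \<ge> N0" for N
      using N0[OF that] F_1_pos[of N] by (simp add: field_simps)
    \<comment> \<open>The comparison starts at \<open>Suc N0\<close> to have a positive lower bound;
      \<open>F 1 0\<close> is zero.\<close>
    have "F 1 (Suc N0) \<le> F 1 (Suc N0 + k)" for k
    proof (induction k)
      case (Suc k)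
      then show ?case using inc[of "Suc N0 + k"] by simp
    qed simp
    moreover have "(\<lambda>k. F 1 (k + Suc N0)) \<longlonglongrightarrow> 0"
      using summable_LIMSEQ_zero[OF F_summable[of 1]] by (rule LIMSEQ_ignore_initial_segment)
    ultimately have "F 1 (Suc N0) \<le> 0"
      by (intro LIMSEQ_le_const) (auto simp: add.commute)
    then show False using F_1_pos[of N0] by simp
  qed
qed

text \<open>A telescoping product of \<open>k\<close> ratios.\<close>

lemma ratio_limit_shift:
  assumes lim: "(\<lambda>N. F 1 N / F 1 (Suc N)) \<longlonglongrightarrow> 1"
  shows "(\<lambda>N. F 1 (N - k) / F 1 N) \<longlonglongrightarrow> 1"
proof (induction k)
  case 0
  have "eventually (\<lambda>N. F 1 N / F 1 N = 1) sequentially"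
  proof (rule eventually_sequentiallyI[of 1])
    fix N :: nat assume "1 \<le> N"
    then show "F 1 N / F 1 N = 1" using F_1_pos[of "N - 1"] by simp
  qed
  then show ?case by (simp add: tendsto_eventually)
next
  case (Suc k)
  have "(\<lambda>N. F 1 N / F 1 (Suc N) * (F 1 (N - k) / F 1 N)) \<longlonglongrightarrow> 1 * 1"
    by (intro tendsto_mult lim Suc)
  moreover have "eventually (\<lambda>N. F 1 N / F 1 (Suc N) * (F 1 (N - k) / F 1 N)
      = F 1 (Suc N - Suc k) / F 1 (Suc N)) sequentially"
  proof (rule eventually_sequentiallyI[of 1])
    fix N :: nat assume "1 \<le> N"
    then have "F 1 N \<noteq> 0" using F_1_pos[of "N - 1"] by simp
    then show "F 1 N / F 1 (Suc N) * (F 1 (N - k) / F 1 N) = F 1 (Suc N - Suc k) / F 1 (Suc N)"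
      by simp
  qed
  ultimately have "(\<lambda>N. F 1 (Suc N - Suc k) / F 1 (Suc N)) \<longlonglongrightarrow> 1"
    by (simp add: tendsto_cong)
  then show ?case by (rule LIMSEQ_imp_Suc)
qed

text \<open>In a large forest one tree carries almost all vertices. Any of the \<open>r\<close> trees can be that tree,
  which gives the lower bound by Fatou's lemma.\<close>

lemma forest_ratio_limit_ge:
  assumes lim: "(\<lambda>N. F 1 N / F 1 (Suc N)) \<longlonglongrightarrow> 1"
    and ex: "\<And>r. r \<le> R \<Longrightarrow> (\<lambda>N. F r N / F 1 N) \<longlonglongrightarrow> c r"
    and "r \<le> R"
  shows "c r \<ge> real r"
  using \<open>r \<le> R\<close>
proof (induction r)
  case 0
  have "0 \<le> c 0"
    using ex[OF 0] by (rule LIMSEQ_le_const) (intro exI[of _ 0] allI impI divide_nonneg_nonneg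
        F_nonneg)
  then show ?case by simp
next
  case (Suc r)
  have shift: "(\<lambda>N. F r (N - j) / F 1 N) \<longlonglongrightarrow> c r" for j
  proof -
    have "(\<lambda>N. F r N / F 1 N) \<longlonglongrightarrow> c r" using ex Suc by simp
    then have "(\<lambda>N. F r (N - j) / F 1 (N - j)) \<longlonglongrightarrow> c r"
      by (intro LIMSEQ_offset[where k = j and f = "\<lambda>N. F r (N - j) / F 1 (N - j)"]) simp
    then have "(\<lambda>N. F r (N - j) / F 1 (N - j) * (F 1 (N - j) / F 1 N)) \<longlonglongrightarrow> c r * 1"
      by (intro tendsto_mult ratio_limit_shift lim)
    moreover have "eventually (\<lambda>N. F r (N - j) / F 1 (N - j) * (F 1 (N - j) / F 1 N)
        = F r (N - j) / F 1 N) sequentially"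
    proof (rule eventually_sequentiallyI[of "Suc j"])
      fix N assume "Suc j \<le> N"
      then have "F 1 (N - j) > 0" using F_1_pos[of "N - Suc j"] by (simp add: Suc_diff_Suc)
      then show "F r (N - j) / F 1 (N - j) * (F 1 (N - j) / F 1 N) = F r (N - j) / F 1 N"
        by simp
    qed
    ultimately show ?thesis unfolding mult_1_right by (rule Lim_transform_eventually)
  qed
  \<comment> \<open>Keep two parts of the convolution for \<open>F (Suc r) N\<close>: the first tree
    has at most \<open>K\<close> vertices, or the other \<open>r\<close> trees together have at most
    \<open>K\<close>. For \<open>N > 2 * K\<close> these cases are disjoint.\<close>
  have bound: "(\<Sum>j\<le>K. F 1 j) * c r + (\<Sum>j\<le>K. F r j) \<le> c (Suc r)" for K
  proof (rule LIMSEQ_le)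
    show "(\<lambda>N. F (Suc r) N / F 1 N) \<longlonglongrightarrow> c (Suc r)" using ex Suc by simp
    show "(\<lambda>N. (\<Sum>j\<le>K. F 1 j * (F r (N - j) / F 1 N)) + (\<Sum>j\<le>K. F r j * (F 1 (N - j) / F 1 N)))
       \<longlonglongrightarrow> (\<Sum>j\<le>K. F 1 j) * c r + (\<Sum>j\<le>K. F r j)"
    proof (rule tendsto_add)
      show "(\<lambda>N. \<Sum>j\<le>K. F 1 j * (F r (N - j) / F 1 N)) \<longlonglongrightarrow> (\<Sum>j\<le>K. F 1 j) * c r"
        unfolding sum_distrib_right by (intro tendsto_sum tendsto_mult_left shift)
      have "(\<lambda>N. \<Sum>j\<le>K. F r j * (F 1 (N - j) / F 1 N)) \<longlonglongrightarrow> (\<Sum>j\<le>K. F r j * 1)"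
        by (intro tendsto_sum tendsto_mult_left ratio_limit_shift lim)
      then show "(\<lambda>N. \<Sum>j\<le>K. F r j * (F 1 (N - j) / F 1 N)) \<longlonglongrightarrow> (\<Sum>j\<le>K. F r j)"
        by simp
    qed
    have "(\<Sum>j\<le>K. F 1 j * (F r (N - j) / F 1 N)) + (\<Sum>j\<le>K. F r j * (F 1 (N - j) / F 1 N))
        \<le> F (Suc r) N / F 1 N" if "N > 2 * K" for N
    proof -
      have "(\<Sum>j\<le>K. F r j * F 1 (N - j)) = (\<Sum>j\<in>{N-K..N}. F 1 j * F r (N - j))"
        using that by (intro sum.reindex_bij_witness[of _ "\<lambda>j. N - j" "\<lambda>j. N - j"]) auto
      then have "(\<Sum>j\<le>K. F 1 j * F r (N - j)) + (\<Sum>j\<le>K. F r j * F 1 (N - j))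
         = (\<Sum>j\<in>{..K} \<union> {N-K..N}. F 1 j * F r (N - j))"
        using that by (subst sum.union_disjoint) auto
      also have "\<dots> \<le> (\<Sum>j\<le>N. F 1 j * F r (N - j))"
        using that by (intro sum_mono2) (auto intro!: mult_nonneg_nonneg F_nonneg)
      also have "\<dots> = F (Suc r) N" using forest_weight_add[of D p 1 r N] by simp
      finally have "((\<Sum>j\<le>K. F 1 j * F r (N - j)) + (\<Sum>j\<le>K. F r j * F 1 (N - j))) / F 1 N
          \<le> F (Suc r) N / F 1 N"
        by (rule divide_right_mono[OF _ F_nonneg])
      then show ?thesis by (simp add: sum_divide_distrib add_divide_distrib)
    qed
    then show "\<exists>N0. \<forall>N\<ge>N0. (\<Sum>j\<le>K. F 1 j * (F r (N - j) / F 1 N)) + (\<Sum>j\<le>K. F r j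
        * (F 1 (N - j) / F 1 N))
        \<le> F (Suc r) N / F 1 N"
      by (intro exI[of _ "Suc (2 * K)"]) auto
  qed
  have "(\<lambda>K. (\<Sum>j\<le>K. F 1 j) * c r + (\<Sum>j\<le>K. F r j)) \<longlonglongrightarrow> 1 * c r + 1"
    using F_sums_1 unfolding sums_def_le by (intro tendsto_intros) auto
  then have "1 * c r + 1 \<le> c (Suc r)"
    by (rule LIMSEQ_le_const2) (use bound in blast)
  then show ?case using Suc by simp
qed

text \<open>Conditioning on the number of children of the root, the limits \<open>c i\<close> satisfy
  \<open>\<Sum>i. p i * c i = 1\<close>. Their lower bounds \<open>i\<close> satisfy the same equation, so they are attained.\<close>

lemma forest_ratio_limit:
  assumes ex: "\<And>i. 1 \<le> i \<Longrightarrow> i \<le> D \<Longrightarrow> convergent (\<lambda>N. F i N / F 1 (Suc N))"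
  shows "(\<lambda>N. F r N / F 1 (N + m)) \<longlonglongrightarrow> real r"
proof -
  have ex1: "convergent (\<lambda>N. F 1 N / F 1 (Suc N))" using ex[of 1] D_ge_2 by simp
  then have lim: "(\<lambda>N. F 1 N / F 1 (Suc N)) \<longlonglongrightarrow> 1"
    using ratio_limit_eq_1 by (auto simp: convergent_def)
  have lim': "(\<lambda>N. F 1 (Suc N) / F 1 N) \<longlonglongrightarrow> 1"
    using tendsto_inverse[OF lim] by simp
  have change: "(\<lambda>N. F i N / F 1 N) \<longlonglongrightarrow> c" if "(\<lambda>N. F i N / F 1 (Suc N)) \<longlonglongrightarrow> c" for i c
  proof -
    have "(\<lambda>N. F i N / F 1 (Suc N) * (F 1 (Suc N) / F 1 N)) \<longlonglongrightarrow> c * 1"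
      by (intro tendsto_mult that lim')
    moreover have "F i N / F 1 (Suc N) * (F 1 (Suc N) / F 1 N) = F i N / F 1 N" for N
      using F_1_pos[of N] by simp
    ultimately show ?thesis by (simp only: mult_1_right)
  qed
  \<comment> \<open>The hypothesis starts at \<open>i = 1\<close>; the empty forest contributes the
    limit 0.\<close>
  have F0: "(\<lambda>N. F 0 N / F 1 (Suc N)) \<longlonglongrightarrow> 0"
    by (rule tendsto_eventually, rule eventually_sequentiallyI[of 1]) (simp add: forest_weight_0)
  define c where "c i = (if i = 0 then 0 else lim (\<lambda>N. F i N / F 1 (Suc N)))" for i
  have c: "(\<lambda>N. F i N / F 1 (Suc N)) \<longlonglongrightarrow> c i" if "i \<le> D" for i
  proof (cases "i = 0")
    case False
    then show ?thesis using ex[of i] that by (simp add: c_def convergent_LIMSEQ_iff)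
  qed (use F0 in \<open>simp add: c_def\<close>)
  have "(\<lambda>N. \<Sum>i\<le>D. p i * (F i N / F 1 (Suc N))) \<longlonglongrightarrow> (\<Sum>i\<le>D. p i * c i)"
    by (intro tendsto_sum tendsto_mult_left c) auto
  moreover have "(\<Sum>i\<le>D. p i * (F i N / F 1 (Suc N))) = 1" for N
  proof -
    have "(\<Sum>i\<le>D. p i * (F i N / F 1 (Suc N))) = F 1 (Suc N) / F 1 (Suc N)"
      by (simp add: forest_weight.simps(3) flip: sum_divide_distrib)
    then show ?thesis using F_1_pos[of N] by simp
  qed
  ultimately have "(\<Sum>i\<le>D. p i * c i) = 1" by (simp add: LIMSEQ_const_iff)
  then have sum0: "(\<Sum>i\<le>D. p i * (c i - real i)) = 0"
    using p_mean by (simp add: right_diff_distrib sum_subtractf mult.commute)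
  have ge: "c i \<ge> real i" if "i \<le> D" for i
    using forest_ratio_limit_ge[OF lim _ that, of c] change c by blast
  have c_eq: "c i = real i" if "i \<le> D" for i
  proof -
    have "p i * (c i - real i) = 0"
      using sum_nonneg_0[OF _ _ sum0, of i] that ge p_pos by (simp add: less_imp_le)
    then show ?thesis using p_pos[of i] by simp
  qed
  have all: "(\<lambda>N. F r N / F 1 (Suc N)) \<longlonglongrightarrow> real r" for r
  proof (induction r rule: less_induct)
    case (less r)
    show ?case
    proof (cases "r \<le> D")
      case True
      then show ?thesis using c c_eq by metis
    next
      case False
      \<comment> \<open>Solve the recursion of \<open>F (Suc q) (Suc N)\<close> for its last term,
        which contains \<open>F r N\<close>. All other forests involved have fewer than
        \<open>r\<close> trees, since \<open>D \<ge> 2\<close>.\<close>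
      define q where "q = r - D"
      have q: "r = q + D" "q \<ge> 1" using False by (auto simp: q_def)
      have "(\<lambda>N. F (Suc q) (Suc N) / F 1 (Suc N)) \<longlonglongrightarrow> real (Suc q)"
        using LIMSEQ_Suc[OF change[OF less.IH[of "Suc q"]]] D_ge_2 q by simp
      moreover have "(\<lambda>N. \<Sum>i<D. p i * (F (q + i) N / F 1 (Suc N))) \<longlonglongrightarrow> (\<Sum>i<D. p i * real (q + i))"
        by (intro tendsto_sum tendsto_mult_left less.IH) (simp add: q(1))
      ultimately have "(\<lambda>N. (F (Suc q) (Suc N) / F 1 (Suc N) - (\<Sum>i<D. p i * (F (q
          + i) N / F 1 (Suc N)))) / p D)
          \<longlonglongrightarrow> (real (Suc q) - (\<Sum>i<D. p i * real (q + i))) / p D"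
        using p_pos[of D] by (intro tendsto_divide tendsto_diff tendsto_const) auto
      moreover have "(F (Suc q) (Suc N) / F 1 (Suc N) - (\<Sum>i<D. p i * (F (q
          + i) N / F 1 (Suc N)))) / p D
          = F r N / F 1 (Suc N)" for N
      proof -
        have "F (Suc q) (Suc N) = (\<Sum>i<D. p i * F (q + i) N) + p D * F r N"
          by (simp add: q(1) forest_weight.simps(3) flip: lessThan_Suc_atMost)
        then show ?thesis using p_pos[of D]
          by (simp add: add_divide_distrib sum_divide_distrib)
      qed
      \<comment> \<open>The number of trees solves the same recursion, because \<open>q + i\<close>
        has mean \<open>q + 1\<close> under \<open>p\<close>.\<close>
      moreover have "(real (Suc q) - (\<Sum>i<D. p i * real (q + i))) / p D = real r"
      proof -
        have "(\<Sum>i\<le>D. p i * real (q + i)) = real q * (\<Sum>i\<le>D. p i) + (\<Sum>i\<le>D. real i * p i)"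
          by (simp add: sum.distrib sum_distrib_left algebra_simps)
        then have "(\<Sum>i<D. p i * real (q + i)) + p D * real r = real (Suc q)"
          unfolding p_sum p_mean by (simp add: q(1) flip: lessThan_Suc_atMost)
        then show ?thesis using p_pos[of D] by (simp add: field_simps)
      qed
      ultimately show ?thesis by simp
    qed
  qed
  have "(\<lambda>N. F r N / F 1 N * (F 1 (N + m - m) / F 1 (N + m))) \<longlonglongrightarrow> real r * 1"
    by (intro tendsto_mult change all LIMSEQ_ignore_initial_segment ratio_limit_shift lim)
  then have "(\<lambda>N. F r N / F 1 N * (F 1 N / F 1 (N + m))) \<longlonglongrightarrow> real r" by simp
  moreover have "eventually (\<lambda>N. F r N / F 1 N * (F 1 N / F 1 (N + m))
      = F r N / F 1 (N + m)) sequentially"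
  proof (rule eventually_sequentiallyI[of 1])
    fix N :: nat assume "1 \<le> N"
    then show "F r N / F 1 N * (F 1 N / F 1 (N + m)) = F r N / F 1 (N + m)"
      using F_1_pos[of "N - 1"] by simp
  qed
  ultimately show ?thesis unfolding mult_1_right by (rule Lim_transform_eventually)
qed

end

section \<open>Completions of a truncated tree\<close>

lemma plane_treesI:
  assumes "[] \<in> T" "\<And>v i. v @ [i] \<in> T \<Longrightarrow> v \<in> T"
    "\<And>v. v \<in> T \<Longrightarrow> k v \<le> D" "\<And>v i. v \<in> T \<Longrightarrow> v @ [i] \<in> T \<longleftrightarrow> i < k v"
  shows "T \<in> plane_trees D"
proof -
  have "\<exists>k'\<le>D. {i. v @ [i] \<in> T} = {..<k'}" if "v \<in> T" for v
    using assms(3,4)[OF that] by (intro exI[of _ "k v"]) auto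
  then show ?thesis unfolding plane_trees_def using assms(1,2) by blast
qed

context
  fixes D :: nat and T :: "nat list set"
  assumes T: "T \<in> plane_trees D"
begin

lemma root_in_tree: "[] \<in> T"
  using T by (simp add: plane_trees_def)

lemma parent_in_tree: "v @ [i] \<in> T \<Longrightarrow> v \<in> T"
  using T by (auto simp: plane_trees_def)

lemma children_eq: "v \<in> T \<Longrightarrow> {i. v @ [i] \<in> T} = {..<branching T v}"
  using T unfolding plane_trees_def branching_def by fastforce

lemma child_in_tree_iff: "v \<in> T \<Longrightarrow> v @ [i] \<in> T \<longleftrightarrow> i < branching T v"
  using children_eq by blast

lemma branching_le: "v \<in> T \<Longrightarrow> branching T v \<le> D"
  using T unfolding plane_trees_def branching_def by fastforce

text \<open>Bounded branching confines a tree to words over a finite alphabet, hence its levels and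
  truncations are finite.\<close>

lemma vertex_letters: "v \<in> T \<Longrightarrow> set v \<subseteq> {..<D}"
proof (induction v rule: rev_induct)
  case (snoc i v)
  then have "v \<in> T" using parent_in_tree by blast
  then show ?case using snoc child_in_tree_iff[of v i] branching_le[of v] by auto
qed simp

lemma finite_level: "finite (level_vertices T n)"
  by (rule finite_subset[OF _ finite_lists_length_le[of "{..<D}" n]])
     (use vertex_letters in \<open>auto simp: level_vertices_def\<close>)

lemma finite_trunc: "finite (trunc n T)"
  by (rule finite_subset[OF _ finite_lists_length_le[of "{..<D}" n]])
     (use vertex_letters in \<open>auto simp: trunc_def\<close>)

lemma branching_trunc: "length v < n \<Longrightarrow> branching (trunc n T) v = branching T v"
  by (simp add: branching_def trunc_def)

lemma trunc_in_plane_trees: "trunc n T \<in> plane_trees D"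
proof (rule plane_treesI)
  show "[] \<in> trunc n T" using root_in_tree by (simp add: trunc_def)
  show "v \<in> trunc n T" if "v @ [i] \<in> trunc n T" for v i
    using that parent_in_tree by (auto simp: trunc_def)
  show "(if length v < n then branching T v else 0) \<le> D" if "v \<in> trunc n T" for v
    using that branching_le by (auto simp: trunc_def)
  show "(v @ [i] \<in> trunc n T) = (i < (if length v < n then branching T v else 0))"
    if "v \<in> trunc n T" for v i
    using that child_in_tree_iff by (auto simp: trunc_def)
qed

end

lemma finite_range_trunc: "finite (trunc n ` plane_trees D)"
proof (rule finite_subset)
  show "trunc n ` plane_trees D \<subseteq> Pow {v. set v \<subseteq> {..<D} \<and> length v \<le> n}"
    using vertex_letters by (force simp: trunc_def)
  show "finite (Pow {v. set v \<subseteq> {..<D} \<and> length v \<le> n})"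
    by (simp add: finite_lists_length_le)
qed

text \<open>The elements of \<open>A\<close> are leaves of \<open>S\<close> at which the tree may grow further.\<close>

definition completions :: "nat \<Rightarrow> nat list set \<Rightarrow> nat list set \<Rightarrow> nat \<Rightarrow> nat list set set" where
  "completions D S A N =
     {T \<in> trees_size D N. S \<subseteq> T \<and> (\<forall>v\<in>S - A. branching T v = branching S v)}"

text \<open>One step of exploring a tree. Besides trees it is also applied to the frontier
  \<open>A - {a}\<close>, which receives the same \<open>i\<close> new vertices.\<close>

definition graft_star :: "nat list set \<Rightarrow> nat list \<Rightarrow> nat \<Rightarrow> nat list set" where
  "graft_star S a i = S \<union> (\<lambda>j. a @ [j]) ` {..<i}"

lemma card_graft_star:
  assumes "finite S" "\<And>j. a @ [j] \<notin> S"
  shows "card (graft_star S a i) = card S + i"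
proof -
  have "card ((\<lambda>j. a @ [j]) ` {..<i}) = i" by (simp add: card_image inj_on_def)
  then show ?thesis using assms unfolding graft_star_def by (subst card_Un_disjoint) auto
qed

context
  fixes D :: nat and S :: "nat list set" and a :: "nat list"
  assumes S: "S \<in> plane_trees D" and a: "a \<in> S" "\<And>j. a @ [j] \<notin> S"
begin

lemma graft_star_child_iff:
  assumes "v \<in> graft_star S a i"
  shows "v @ [j] \<in> graft_star S a i \<longleftrightarrow> (if v \<in> S then if v
      = a then j < i else j < branching S v else False)"
proof -
  have "v @ [j] \<notin> S" if "v = a @ [l]" for l
    using parent_in_tree[OF S, of "a @ [l]" j] a that by auto
  then show ?thesis
    using assms a child_in_tree_iff[OF S, of v j] by (auto simp: graft_star_def)
qed

lemma branching_graft_star: "v \<in> S \<Longrightarrow> branching (graft_star S a i) v = (if v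
    = a then i else branching S v)"
  using graft_star_child_iff[of v i] by (simp add: branching_def graft_star_def)

lemma graft_star_in_plane_trees:
  assumes "i \<le> D"
  shows "graft_star S a i \<in> plane_trees D"
proof (rule plane_treesI)
  show "[] \<in> graft_star S a i" using root_in_tree[OF S] by (simp add: graft_star_def)
  show "v \<in> graft_star S a i" if "v @ [j] \<in> graft_star S a i" for v j
    using that parent_in_tree[OF S] a by (auto simp: graft_star_def)
  show "(if v \<in> S then if v = a then i else branching S v else 0) \<le> D" for v
    using branching_le[OF S] assms by auto
  show "v @ [j] \<in> graft_star S a i \<longleftrightarrow> j < (if v \<in> S then if v = a then i else branching S v else 0)"
    if "v \<in> graft_star S a i" for v j
    using graft_star_child_iff[OF that] by simp
qed

end

text \<open>With every branching number in \<open>S\<close> prescribed, no vertex outside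
  \<open>S\<close> can be attached; induction along the word of a vertex shows this.\<close>

lemma completions_empty:
  assumes S: "S \<in> plane_trees D" "finite S"
  shows "completions D S {} N = (if card S = N then {S} else {})"
proof -
  have "T = S" if T: "T \<in> plane_trees D" "S \<subseteq> T" "\<forall>v\<in>S. branching T v = branching S v" for T
  proof -
    have "v \<in> S" if "v \<in> T" for v using that
    proof (induction v rule: rev_induct)
      case Nil
      then show ?case using root_in_tree[OF S(1)] by simp
    next
      case (snoc i v)
      then have "v \<in> T" "v \<in> S" using parent_in_tree[OF T(1)] by blast+
      then show ?case
        using snoc.prems T child_in_tree_iff[OF T(1)] child_in_tree_iff[OF S(1)] by auto
    qed
    then show ?thesis using T by auto
  qed
  then show ?thesis using S by (auto simp: completions_def trees_size_def)
qed

text \<open>Completions are classified by the branching number of the frontier leaf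
  \<open>a\<close>, which thereby becomes prescribed. This mirrors the recursion of
  \<open>forest_weight\<close>.\<close>

lemma completions_split:
  assumes S: "S \<in> plane_trees D" "A \<subseteq> S" "\<forall>a\<in>A. \<forall>j. a @ [j] \<notin> S" and a: "a \<in> A"
  defines "A' \<equiv> graft_star (A - {a}) a"
  shows "completions D S A N = (\<Union>i\<le>D. completions D (graft_star S a i) (A' i) N)"
    and "i \<noteq> j \<Longrightarrow> completions D (graft_star S a i) (A' i) N \<inter> completions D (graft_star S a j) (A'
        j) N = {}"
    and "graft_star S a i - A' i = insert a (S - A)"
proof -
  have aS: "a \<in> S" "\<And>j. a @ [j] \<notin> S" using S a by auto
  show diff: "graft_star S a i - A' i = insert a (S - A)" for i
    using S a aS by (auto simp: graft_star_def A'_def)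
  have br: "branching (graft_star S a i) v = (if v = a then i else branching S v)"
    if "v \<in> insert a (S - A)" for v i
    using that aS by (intro branching_graft_star[OF S(1) aS]) auto
  have mem: "T \<in> completions D (graft_star S a i) (A' i) N \<longleftrightarrow>
      T \<in> completions D S A N \<and> branching T a = i" for T i
  proof -
    have "graft_star S a i \<subseteq> T \<longleftrightarrow> S \<subseteq> T" if "T \<in> plane_trees D" "branching T a = i"
      using that child_in_tree_iff[OF that(1), of a] aS by (auto simp: graft_star_def)
    moreover have "(\<forall>v\<in>insert a (S - A). branching T v = branching (graft_star S a i) v) \<longleftrightarrow>
       branching T a = i \<and> (\<forall>v\<in>S - A. branching T v = branching S v)"
      using a br by auto
    ultimately show ?thesis
      unfolding completions_def diff trees_size_def by auto
  qed
  show "completions D S A N = (\<Union>i\<le>D. completions D (graft_star S a i) (A' i) N)"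
  proof -
    have "branching T a \<le> D" if "T \<in> completions D S A N" for T
      using that aS branching_le[of T D a] by (auto simp: completions_def trees_size_def)
    then show ?thesis using mem by auto
  qed
  show "i \<noteq> j \<Longrightarrow> completions D (graft_star S a i) (A' i) N \<inter> completions D (graft_star S a j) (A'
      j) N = {}"
    using mem by auto
qed

text \<open>Here \<open>k\<close> is the number of vertices whose branching number is not prescribed by \<open>S\<close>.\<close>

lemma completions_weight:
  assumes "S \<in> plane_trees D" "finite S" "A \<subseteq> S" "\<And>a j. a \<in> A \<Longrightarrow> a @ [j] \<notin> S"
    and "k + card S = N + card A"
  shows "finite (completions D S A N) \<and>
    (\<Sum>T\<in>completions D S A N. \<Prod>v\<in>T. w (branching T v)) =
      (\<Prod>v\<in>S - A. w (branching S v)) * forest_weight D w (card A) k"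
  using assms
proof (induction k arbitrary: S A)
  case 0
  show ?case
  proof (cases "A = {}")
    case True
    then show ?thesis using 0 completions_empty[of S D N] by auto
  next
    case False
    then have "card A > 0" using finite_subset[OF 0(3,2)] by (simp add: card_gt_0_iff)
    \<comment> \<open>Here \<open>k = 0\<close> and \<open>A\<close> is nonempty, so
      \<open>N < card S\<close> and no tree of size \<open>N\<close> contains
      \<open>S\<close>.\<close>
    have "completions D S A N = {}"
    proof -
      have "card S \<le> N" if "T \<in> completions D S A N" for T
        using that card_mono[of T S] by (auto simp: completions_def trees_size_def)
      then show ?thesis using 0 \<open>card A > 0\<close> by fastforce
    qed
    then show ?thesis using \<open>card A > 0\<close> by simp
  qed
next
  case (Suc k)
  show ?case
  proof (cases "A = {}")
    case True
    then show ?thesis using Suc.prems completions_empty[of S D N] by auto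
  next
    case False
    then obtain a where a: "a \<in> A" by blast
    have aS: "a \<in> S" "\<And>j. a @ [j] \<notin> S" using Suc.prems a by auto
    have fin: "finite A" using Suc.prems finite_subset by blast
    define A' where "A' = graft_star (A - {a}) a"
    define r where "r = card A - 1"
    have r: "card A = Suc r" using a fin card_gt_0_iff[of A] by (auto simp: r_def)
    have "\<forall>a\<in>A. \<forall>j. a @ [j] \<notin> S" using Suc.prems(4) by blast
    note split = completions_split[OF Suc.prems(1,3) this a, folded A'_def]
    have cA': "card (A' i) = r + i" for i
      unfolding A'_def using fin a aS Suc.prems(3) by (subst card_graft_star) (auto simp: r_def)
    have IH: "finite (completions D (graft_star S a i) (A' i) N) \<and>
      (\<Sum>T\<in>completions D (graft_star S a i) (A' i) N. \<Prod>v\<in>T. w (branching T v)) =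
      (\<Prod>v\<in>graft_star S a i - A' i. w (branching (graft_star S a i) v))
          * forest_weight D w (card (A' i)) k"
      if "i \<le> D" for i
    proof (rule Suc.IH)
      show "graft_star S a i \<in> plane_trees D"
        by (rule graft_star_in_plane_trees[OF Suc.prems(1) aS that])
      show "finite (graft_star S a i)" using Suc.prems by (simp add: graft_star_def)
      show "A' i \<subseteq> graft_star S a i" using Suc.prems by (auto simp: A'_def graft_star_def)
      show "b @ [j] \<notin> graft_star S a i" if "b \<in> A' i" for b j
      proof -
        have "b \<in> graft_star S a i" using that Suc.prems by (auto simp: A'_def graft_star_def)
        moreover have "b \<noteq> a" using that by (auto simp: A'_def graft_star_def)
        moreover have "b \<in> S \<Longrightarrow> b \<in> A" using that aS by (auto simp: A'_def graft_star_def)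
        ultimately show ?thesis
          using graft_star_child_iff[OF Suc.prems(1) aS, of b i j] Suc.prems(4)[of b j]
            child_in_tree_iff[OF Suc.prems(1), of b j] by auto
      qed
      show "k + card (graft_star S a i) = N + card (A' i)"
        using Suc.prems(5) r card_graft_star[OF Suc.prems(2) aS(2)] cA' by simp
    qed
    have prod: "(\<Prod>v\<in>graft_star S a i - A' i. w (branching (graft_star S a i) v))
      = w i * (\<Prod>v\<in>S - A. w (branching S v))" for i
    proof -
      have "(\<Prod>v\<in>insert a (S - A). w (branching (graft_star S a i) v)) =
         w i * (\<Prod>v\<in>S - A. w (branching (graft_star S a i) v))"
        using a Suc.prems(2) branching_graft_star[OF Suc.prems(1) aS aS(1)] by simp
      also have "(\<Prod>v\<in>S - A. w (branching (graft_star S a i) v)) = (\<Prod>v\<in>S - A. w (branching S v))"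
      proof (rule prod.cong)
        fix v assume "v \<in> S - A"
        then have "v \<in> S" "v \<noteq> a" using a by auto
        then show "w (branching (graft_star S a i) v) = w (branching S v)"
          using branching_graft_star[OF Suc.prems(1) aS, of v i] by simp
      qed simp
      finally show ?thesis by (simp add: split(3))
    qed
    have "(\<Sum>T\<in>completions D S A N. \<Prod>v\<in>T. w (branching T v)) =
      (\<Sum>i\<le>D. \<Sum>T\<in>completions D (graft_star S a i) (A' i) N. \<Prod>v\<in>T. w (branching T v))"
      unfolding split(1) using IH split(2) by (intro sum.UNION_disjoint) auto
    also have "\<dots> = (\<Prod>v\<in>S - A. w (branching S v)) * forest_weight D w (card A) (Suc k)"
      using IH by (simp add: prod r cA' forest_weight.simps(3) sum_distrib_left mult_ac)
    finally show ?thesis using IH split(1) by simp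
  qed
qed

text \<open>Truncation shows all children of vertices below height \<open>n\<close>, so the trees
  truncating to \<open>S\<close> are its completions with level \<open>n\<close> as
  frontier.\<close>

lemma trunc_eq_iff:
  assumes S: "S \<in> plane_trees D" "\<forall>v\<in>S. length v \<le> n" and T: "T \<in> plane_trees D"
  shows "trunc n T = S \<longleftrightarrow> S \<subseteq> T \<and> (\<forall>v\<in>S - level_vertices S n. branching T v = branching S v)"
proof
  assume eq: "trunc n T = S"
  have "branching T v = branching S v" if "v \<in> S - level_vertices S n" for v
  proof -
    have "length v < n" using that S(2) by (auto simp: level_vertices_def)
    then show ?thesis using branching_trunc[OF T, of v n] eq by simp
  qed
  then show "S \<subseteq> T \<and> (\<forall>v\<in>S - level_vertices S n. branching T v = branching S v)"
    using eq by (auto simp: trunc_def)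
next
  assume R: "S \<subseteq> T \<and> (\<forall>v\<in>S - level_vertices S n. branching T v = branching S v)"
  have "v \<in> S" if "v \<in> T" "length v \<le> n" for v using that
  proof (induction v rule: rev_induct)
    case Nil
    then show ?case using root_in_tree[OF S(1)] by simp
  next
    case (snoc i v)
    then have "v \<in> T" "v \<in> S" using parent_in_tree[OF T] by auto
    moreover have "branching T v = branching S v"
      using R snoc.prems \<open>v \<in> S\<close> by (auto simp: level_vertices_def)
    ultimately show ?case
      using snoc.prems child_in_tree_iff[OF T] child_in_tree_iff[OF S(1)] by auto
  qed
  then show "trunc n T = S" using R S by (auto simp: trunc_def)
qed

text \<open>The \<open>m\<close> vertices below height \<open>n\<close> have prescribed branching
  numbers; the other \<open>N\<close> form a forest rooted at level \<open>n\<close>.\<close>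

lemma trees_size_trunc_weight:
  assumes S: "S \<in> plane_trees D" "finite S" "\<forall>v\<in>S. length v \<le> n"
    and m: "m = card {v \<in> S. length v < n}"
  shows "finite {T \<in> trees_size D (N + m). trunc n T = S}"
    and "(\<Sum>T | T \<in> trees_size D (N + m) \<and> trunc n T = S. \<Prod>v\<in>T. w (branching T v)) =
      (\<Prod>v | v \<in> S \<and> length v < n. w (branching S v))
          * forest_weight D w (card (level_vertices S n)) N"
proof -
  have eq: "{T \<in> trees_size D (N + m). trunc n T = S}
      = completions D S (level_vertices S n) (N + m)"
    using trunc_eq_iff[OF S(1,3)] by (auto simp: completions_def trees_size_def)
  have diff: "S - level_vertices S n = {v \<in> S. length v < n}"
    using S(3) by (force simp: level_vertices_def)
  have sub: "level_vertices S n \<subseteq> S" by (auto simp: level_vertices_def)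
  have "card S = m + card (level_vertices S n)"
    using card_Diff_subset[OF finite_subset[OF sub S(2)] sub] card_mono[OF S(2) sub] diff m by simp
  moreover have "a @ [j] \<notin> S" if "a \<in> level_vertices S n" for a j
    using that S(3) by (auto simp: level_vertices_def)
  ultimately show "finite {T \<in> trees_size D (N + m). trunc n T = S}"
    "(\<Sum>T | T \<in> trees_size D (N + m) \<and> trunc n T = S. \<Prod>v\<in>T. w (branching T v)) =
      (\<Prod>v | v \<in> S \<and> length v < n. w (branching S v))
          * forest_weight D w (card (level_vertices S n)) N"
    using completions_weight[OF S(1,2) sub, where k = N and N = "N + m" and w = w]
    unfolding eq diff by auto
qed

text \<open>The case \<open>n = 0\<close> of truncation: every tree truncates to its root and is a
  forest of one tree.\<close>

lemma trees_size_weight: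
  shows "finite (trees_size D N)"
    and "(\<Sum>T\<in>trees_size D N. \<Prod>v\<in>T. w (branching T v)) = forest_weight D w 1 N"
proof -
  have S: "{[]} \<in> plane_trees D" by (auto simp: plane_trees_def)
  have "{T \<in> trees_size D (N + 0). trunc 0 T = {[]}} = trees_size D N"
    using root_in_tree by (auto simp: trees_size_def trunc_def)
  moreover have "level_vertices {[]} 0 = {[]}" by (auto simp: level_vertices_def)
  ultimately show "finite (trees_size D N)"
    "(\<Sum>T\<in>trees_size D N. \<Prod>v\<in>T. w (branching T v)) = forest_weight D w 1 N"
    using trees_size_trunc_weight[OF S, where n = 0 and m = 0 and N = N] by auto
qed

section \<open>Level codes\<close>

lemma rank_bij_betw:
  fixes L :: "'a::linorder set"
  assumes "finite L"
  shows "bij_betw (\<lambda>v. card {u \<in> L. u \<le> v}) L {1..card L}"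
proof -
  let ?r = "\<lambda>v. card {u \<in> L. u \<le> v}"
  have less: "?r u < ?r v" if "u \<in> L" "v \<in> L" "u < v" for u v
  proof (rule psubset_card_mono)
    have "v \<in> {w \<in> L. w \<le> v} - {w \<in> L. w \<le> u}" using that by auto
    then show "{w \<in> L. w \<le> u} \<subset> {w \<in> L. w \<le> v}" using that by fastforce
  qed (use assms in simp)
  then have inj: "inj_on ?r L"
    by (intro linorder_inj_onI') fastforce+
  have "?r ` L \<subseteq> {1..card L}"
  proof (intro image_subsetI)
    fix v assume v: "v \<in> L"
    have "?r v > 0" using assms v by (auto simp: card_gt_0_iff)
    moreover have "?r v \<le> card L" using assms by (intro card_mono) auto
    ultimately show "?r v \<in> {1..card L}" by simp
  qed
  then have "?r ` L = {1..card L}"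
    using inj by (intro card_subset_eq) (auto simp: card_image)
  then show ?thesis using inj by (simp add: bij_betw_def)
qed

lemma butlast_mono:
  fixes u v :: "'a::linorder list"
  assumes "length u = length v" "u \<le> v"
  shows "butlast u \<le> butlast v"
  using assms by (induction u v rule: list_induct2) auto

lemma level_vertices_trunc: "n \<le> m \<Longrightarrow> level_vertices (trunc m T) n = level_vertices T n"
  by (auto simp: level_vertices_def trunc_def)

lemma vertex_number_trunc: "length v \<le> m \<Longrightarrow> vertex_number (trunc m T) v = vertex_number T v"
  by (simp add: vertex_number_def level_vertices_trunc)

lemma level_code_Suc:
  "level_code (Suc n) T l =
     (let vs = sorted_list_of_set (level_vertices T (Suc n))
      in if l < length vs then vertex_number T (butlast (vs ! l)) else 0)"
  by (simp add: level_code_def)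

context
  fixes D :: nat and T :: "nat list set"
  assumes T: "T \<in> plane_trees D"
begin

lemma level_0: "level_vertices T 0 = {[]}"
  using root_in_tree[OF T] by (auto simp: level_vertices_def)

lemma level_Suc:
  "level_vertices T (Suc n) = (\<Union>v\<in>level_vertices T n. (\<lambda>i. v @ [i]) ` {..<branching T v})"
proof (intro set_eqI iffI)
  fix u assume u: "u \<in> level_vertices T (Suc n)"
  then obtain v i where "u = v @ [i]" by (cases u rule: rev_cases) (auto simp: level_vertices_def)
  then show "u \<in> (\<Union>v\<in>level_vertices T n. (\<lambda>i. v @ [i]) ` {..<branching T v})"
    using u parent_in_tree[OF T, of v i] child_in_tree_iff[OF T, of v i]
    by (auto simp: level_vertices_def)
qed (auto simp: level_vertices_def child_in_tree_iff[OF T])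

lemma trunc_Suc: "trunc (Suc n) T = trunc n T \<union> level_vertices T (Suc n)"
  by (auto simp: trunc_def level_vertices_def)

lemma vertex_number_bij_betw:
  "bij_betw (vertex_number T) (level_vertices T n) {1..card (level_vertices T n)}"
  using rank_bij_betw[OF finite_level[OF T, of n]]
  by (rule bij_betw_cong[THEN iffD1, rotated]) (auto simp: vertex_number_def level_vertices_def)

lemma vertex_number_range:
  "v \<in> level_vertices T n \<Longrightarrow> 1 \<le> vertex_number T v \<and> vertex_number T v \<le> card (level_vertices T n)"
  using bij_betwE[OF vertex_number_bij_betw] by fastforce

lemma vertex_number_cases:
  assumes "1 \<le> i" "i \<le> card (level_vertices T n)"
  obtains v where "v \<in> level_vertices T n" "vertex_number T v = i"
proof -
  have "i \<in> vertex_number T ` level_vertices T n"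
    using assms bij_betw_imp_surj_on[OF vertex_number_bij_betw] by simp
  then show ?thesis using that by blast
qed

lemma vertex_number_mono:
  assumes "length u = length v" "u \<le> v"
  shows "vertex_number T u \<le> vertex_number T v"
  unfolding vertex_number_def using assms finite_level[OF T] by (intro card_mono) auto

lemma parent_in_level: "v \<in> level_vertices T (Suc n) \<Longrightarrow> butlast v \<in> level_vertices T n"
  by (auto simp: level_Suc)

lemma level_code_cases:
  obtains "l < card (level_vertices T (Suc n))"
      "sorted_list_of_set (level_vertices T (Suc n)) ! l \<in> level_vertices T (Suc n)"
      "level_code (Suc n) T l = vertex_number T (butlast (sorted_list_of_set (level_vertices T
          (Suc n)) ! l))"
  | "l \<ge> card (level_vertices T (Suc n))" "level_code (Suc n) T l = 0"
proof (cases "l < card (level_vertices T (Suc n))")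
  case True
  have "sorted_list_of_set (level_vertices T (Suc n)) ! l \<in> set (sorted_list_of_set
      (level_vertices T (Suc n)))"
    using True by (intro nth_mem) simp
  then show ?thesis using True that(1) finite_level[OF T] by (simp add: level_code_Suc)
next
  case False
  then show ?thesis using that(2) by (simp add: level_code_Suc)
qed

lemma level_code_le: "level_code (Suc n) T l \<le> card (level_vertices T n)"
  using vertex_number_range parent_in_level by (cases rule: level_code_cases[of l n]) auto

lemma level_code_nonzero_iff: "level_code n T l \<noteq> 0 \<longleftrightarrow> l < card (level_vertices T n)"
proof (cases n)
  case 0
  then show ?thesis by (simp add: level_code_def level_0)
next
  case (Suc m)
  show ?thesis unfolding Suc
    by (cases rule: level_code_cases[of l m]) (use vertex_number_range parent_in_level in
        fastforce)+
qed

lemma level_size_level_code: "level_size (level_code n T) = card (level_vertices T n)"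
  by (simp only: level_size_def level_code_nonzero_iff flip: lessThan_def) simp

lemma level_follows_level_code: "level_code n T \<lhd>\<^sub>l level_code (Suc n) T"
  by (simp add: level_follows_def level_size_level_code level_code_le)

text \<open>Vertex numbers are injective on a level, so the positions with this entry are those of
  the children of \<open>v\<close>. Thus a code reveals the branching numbers one level
  below.\<close>

lemma card_level_code_eq:
  assumes v: "v \<in> level_vertices T n"
  shows "card {l. level_code (Suc n) T l = vertex_number T v} = branching T v"
proof -
  define L where "L = level_vertices T (Suc n)"
  define vs where "vs = sorted_list_of_set L"
  have L: "finite L" "set vs = L" "length vs = card L" "distinct vs"
    using finite_level[OF T] by (auto simp: L_def vs_def)
  have "{l. level_code (Suc n) T l = vertex_number T v} = {l. l < length vs \<and> butlast (vs ! l) = v}"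
  proof (intro set_eqI)
    fix l
    show "l \<in> {l. level_code (Suc n) T l = vertex_number T v}
        \<longleftrightarrow> l \<in> {l. l < length vs \<and> butlast (vs ! l) = v}"
    proof (cases "l < length vs")
      case True
      then have "butlast (vs ! l) \<in> level_vertices T n"
        using L parent_in_level unfolding L_def by (metis nth_mem)
      then have "vertex_number T (butlast (vs ! l)) = vertex_number T v \<longleftrightarrow> butlast (vs ! l) = v"
        using bij_betw_imp_inj_on[OF vertex_number_bij_betw] v by (meson inj_on_eq_iff)
      moreover have "level_code (Suc n) T l = vertex_number T (butlast (vs ! l))"
        using True by (simp add: level_code_Suc vs_def L_def)
      ultimately show ?thesis using True by simp
    next
      case False
      \<comment> \<open>The padding value 0 is never a vertex number, since the numbering starts at
        1.\<close>
      then have "level_code (Suc n) T l = 0" by (simp add: level_code_Suc vs_def L_def)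
      then show ?thesis using False vertex_number_range[OF v] by simp
    qed
  qed
  moreover have "card {l. l < length vs \<and> butlast (vs ! l) = v}
      = card ((!) vs ` {l. l < length vs \<and> butlast (vs ! l) = v})"
    using L by (intro card_image[symmetric] inj_onI) (auto simp: nth_eq_iff_index_eq)
  moreover have "(!) vs ` {l. l < length vs \<and> butlast (vs ! l) = v} = {u \<in> L. butlast u = v}"
    using L(2) by (fastforce simp: in_set_conv_nth)
  moreover have "{u \<in> L. butlast u = v} = (\<lambda>i. v @ [i]) ` {..<branching T v}"
    using v by (auto simp: L_def level_Suc)
  moreover have "card ((\<lambda>i. v @ [i]) ` {..<branching T v}) = branching T v"
    by (simp add: card_image inj_on_def)
  ultimately show ?thesis by simp
qed

lemma level_code_in_levels: "level_code (Suc n) T \<in> levels D"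
  unfolding levels_def
proof (intro CollectI exI[of _ "card (level_vertices T (Suc n))"] conjI allI impI)
  show "level_code (Suc n) T l \<noteq> 0 \<longleftrightarrow> l < card (level_vertices T (Suc n))" for l
    by (rule level_code_nonzero_iff)
  show "mono_on {..<card (level_vertices T (Suc n))} (level_code (Suc n) T)"
  proof (rule mono_onI)
    fix k l assume kl: "k \<in> {..<card (level_vertices T (Suc n))}" "l \<in> {..<card (level_vertices T
        (Suc n))}" "k \<le> l"
    define vs where "vs = sorted_list_of_set (level_vertices T (Suc n))"
    have vs: "set vs = level_vertices T (Suc n)" "length vs = card (level_vertices T (Suc n))"
      using finite_level[OF T] by (auto simp: vs_def)
    have "sorted vs" by (simp add: vs_def)
    then have "vs ! k \<le> vs ! l" using kl vs by (intro sorted_nth_mono) auto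
    moreover have "length (vs ! j) = Suc n" if "j < length vs" for j
      using nth_mem[OF that] vs by (auto simp: level_vertices_def)
    ultimately have "vertex_number T (butlast (vs ! k)) \<le> vertex_number T (butlast (vs ! l))"
      using kl vs by (intro vertex_number_mono butlast_mono) auto
    then show "level_code (Suc n) T k \<le> level_code (Suc n) T l"
      using kl by (simp add: level_code_Suc vs_def)
  qed
  show "card {l. level_code (Suc n) T l = i} \<le> D" if "0 < i" for i
  proof (cases "i \<le> card (level_vertices T n)")
    case True
    then obtain v where "v \<in> level_vertices T n" "vertex_number T v = i"
      using \<open>0 < i\<close> vertex_number_cases[of i n] by auto
    then show ?thesis
      using card_level_code_eq[of v n] branching_le[OF T, of v] by (auto simp: level_vertices_def)
  next
    case False
    then have "{l. level_code (Suc n) T l = i} = {}" using level_code_le by fastforce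
    then show ?thesis by simp
  qed
qed

lemma level_energy_level_code:
  "level_energy e (level_code n T) (level_code (Suc n) T)
      = (\<Sum>v\<in>level_vertices T n. e (branching T v))"
proof -
  have "(\<Sum>v\<in>level_vertices T n. e (branching T v)) =
      (\<Sum>v\<in>level_vertices T n. e (card {l. level_code (Suc n) T l = vertex_number T v}))"
    by (simp add: card_level_code_eq)
  also have "\<dots> = level_energy e (level_code n T) (level_code (Suc n) T)"
    unfolding level_energy_def level_size_level_code
    using sum.reindex_bij_betw[OF vertex_number_bij_betw] by fastforce
  finally show ?thesis by simp
qed

lemma level_code_trunc:
  assumes "n \<le> m"
  shows "level_code n (trunc m T) = level_code n T"
proof (cases n)
  case 0
  then show ?thesis by (simp add: level_code_def fun_eq_iff)
next
  case (Suc k)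
  show ?thesis
  proof
    fix l
    show "level_code n (trunc m T) l = level_code n T l"
    proof (cases rule: level_code_cases[of l k])
      case 1
      have "length (butlast (sorted_list_of_set (level_vertices T (Suc k)) ! l)) \<le> m"
        using 1(2) assms Suc by (simp add: level_vertices_def)
      then show ?thesis using assms Suc
        by (simp add: level_code_Suc level_vertices_trunc vertex_number_trunc)
    next
      case 2
      then show ?thesis using assms Suc by (simp add: level_code_Suc level_vertices_trunc)
    qed
  qed
qed

end

text \<open>Given the tree up to height \<open>n\<close>, the next code yields by counting the
  branching numbers on level \<open>n\<close>, and these generate level
  \<open>n + 1\<close>.\<close>

lemma trunc_eqI:
  assumes T: "T \<in> plane_trees D" "T' \<in> plane_trees D"
    and "\<And>k. k \<le> n \<Longrightarrow> level_code k T = level_code k T'"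
  shows "trunc n T = trunc n T'"
  using assms(3)
proof (induction n)
  case 0
  show ?case using root_in_tree[OF T(1)] root_in_tree[OF T(2)] by (auto simp: trunc_def)
next
  case (Suc n)
  then have eq: "trunc n T = trunc n T'" by simp
  have lev: "level_vertices T n = level_vertices T' n"
    using level_vertices_trunc[of n n T] level_vertices_trunc[of n n T'] eq by simp
  have "branching T v = branching T' v" if "v \<in> level_vertices T n" for v
  proof -
    have "vertex_number T v = vertex_number T' v"
      using that vertex_number_trunc[of v n T] vertex_number_trunc[of v n T'] eq
      by (simp add: level_vertices_def)
    then show ?thesis
      using card_level_code_eq[OF T(1) that] card_level_code_eq[OF T(2), of v n] that lev
        Suc.prems[of "Suc n"] by simp
  qed
  then have "level_vertices T (Suc n) = level_vertices T' (Suc n)"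
    using lev by (simp add: level_Suc[OF T(1)] level_Suc[OF T(2)])
  then show ?case using eq by (simp add: trunc_Suc[OF T(1)] trunc_Suc[OF T(2)])
qed

text \<open>The nonzero part of a level is a sorted list, hence determined by its multiset of
  entries.\<close>

lemma levels_eqI:
  assumes "g \<in> levels D" "g' \<in> levels D"
    and eq: "\<And>i. i > 0 \<Longrightarrow> card {l. g l = i} = card {l. g' l = i}"
  shows "g = g'"
proof -
  obtain r where r: "\<And>l. g l \<noteq> 0 \<longleftrightarrow> l < r" "mono_on {..<r} g"
    using assms(1) by (auto simp: levels_def)
  obtain r' where r': "\<And>l. g' l \<noteq> 0 \<longleftrightarrow> l < r'" "mono_on {..<r'} g'"
    using assms(2) by (auto simp: levels_def)
  have count: "count (mset (map h [0..<s])) i = (if i = 0 then 0 else card {l. h l = i})"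
    if h: "\<And>l. h l \<noteq> 0 \<longleftrightarrow> l < s" for h :: "nat \<Rightarrow> nat" and s i
  proof -
    have "count (mset (map h [0..<s])) i = card {l. l < s \<and> h l = i}"
      unfolding count_mset count_list_eq_length_filter length_filter_conv_card
      by (intro arg_cong[of _ _ card]) auto
    moreover have "{l. l < s \<and> h l = i} = (if i = 0 then {} else {l. h l = i})"
      using h by (auto simp flip: h)
    ultimately show ?thesis by simp
  qed
  have "mset (map g [0..<r]) = mset (map g' [0..<r'])"
  proof (rule multiset_eqI)
    show "count (mset (map g [0..<r])) i = count (mset (map g' [0..<r'])) i" for i
      using eq[of i] unfolding count[OF r(1)] count[OF r'(1)] by simp
  qed
  moreover have "sorted (map g [0..<r])" "sorted (map g' [0..<r'])"
    using r(2) r'(2) by (auto simp: sorted_iff_nth_mono mono_on_def)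
  ultimately have map_eq: "map g [0..<r] = map g' [0..<r']"
    by (metis properties_for_sort)
  have "r = r'" using arg_cong[OF map_eq, of length] by simp
  show ?thesis
  proof
    fix l
    show "g l = g' l"
    proof (cases "l < r")
      case True
      then show ?thesis using map_eq \<open>r = r'\<close> by auto
    next
      case False
      then show ?thesis using r(1)[of l] r'(1)[of l] \<open>r = r'\<close> by simp
    qed
  qed
qed

text \<open>Each vertex of level \<open>n\<close> receives as many children as \<open>g\<close> has
  entries equal to its number. Membership in \<open>levels D\<close> bounds these by
  \<open>D\<close>, and \<open>\<lhd>\<^sub>l\<close> ensures that no entry of \<open>g\<close>
  lacks a parent.\<close>

lemma level_extension:
  assumes T: "T \<in> plane_trees D" and g: "g \<in> levels D" "level_code n T \<lhd>\<^sub>l g"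
  obtains T' where "T' \<in> plane_trees D" "trunc n T' = trunc n T" "level_code (Suc n) T' = g"
proof -
  define k where "k v = card {l. g l = vertex_number T v}" for v
  define T' where "T' = trunc n T \<union> (\<Union>v\<in>level_vertices T n. (\<lambda>i. v @ [i]) ` {..<k v})"
  have tr: "trunc n T' = trunc n T"
    by (auto simp: T'_def trunc_def level_vertices_def)
  \<comment> \<open>The branching numbers of \<open>T'\<close>; the new vertices at height
    \<open>n + 1\<close> are leaves.\<close>
  define b where "b v = (if length v < n then branching T v else if length v
      = n then k v else 0)" for v
  have child: "v @ [i] \<in> T' \<longleftrightarrow> i < b v" if "v \<in> T'" for v i
    using that child_in_tree_iff[OF T, of v i]
    by (auto simp: T'_def trunc_def level_vertices_def b_def)
  have T': "T' \<in> plane_trees D"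
  proof (rule plane_treesI)
    show "[] \<in> T'" using root_in_tree[OF T] by (simp add: T'_def trunc_def)
    show "v \<in> T'" if "v @ [i] \<in> T'" for v i
      using that parent_in_tree[OF T, of v i] by (auto simp: T'_def trunc_def level_vertices_def)
    show "b v \<le> D" if "v \<in> T'" for v
    proof -
      have "k v \<le> D" if "v \<in> level_vertices T n"
        using vertex_number_range[OF T that] g(1) by (auto simp: k_def levels_def)
      then show ?thesis
        using that branching_le[OF T, of v] by
            (auto simp: b_def T'_def trunc_def level_vertices_def)
    qed
  qed (rule child)
  have lev: "level_vertices T' n = level_vertices T n"
    using level_vertices_trunc[of n n T] level_vertices_trunc[of n n T'] tr by simp
  have "level_code (Suc n) T' = g"
  proof (rule levels_eqI[OF level_code_in_levels[OF T'] g(1)])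
    fix i :: nat assume "i > 0"
    show "card {l. level_code (Suc n) T' l = i} = card {l. g l = i}"
    proof (cases "i \<le> card (level_vertices T n)")
      case True
      then obtain v where v: "v \<in> level_vertices T n" "vertex_number T v = i"
        using \<open>i > 0\<close> vertex_number_cases[OF T, of i n] by auto
      have "vertex_number T' v = i"
        using v vertex_number_trunc[of v n T] vertex_number_trunc[of v n T'] tr
        by (simp add: level_vertices_def)
      then have "card {l. level_code (Suc n) T' l = i} = branching T' v"
        using card_level_code_eq[OF T', of v n] v lev by simp
      also have "\<dots> = k v"
      proof -
        have "v \<in> T'" "b v = k v" using v lev by (auto simp: b_def level_vertices_def)
        then show ?thesis using child[of v] by (simp add: branching_def)
      qed
      finally show ?thesis using v by (simp add: k_def)
    next
      case False
      then have "{l. level_code (Suc n) T' l = i} = {}" "{l. g l = i} = {}"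
        using level_code_le[OF T', of n] lev g(2) level_size_level_code[OF T, of n]
        by (fastforce simp: level_follows_def)+
      then show ?thesis by simp
    qed
  qed
  then show ?thesis using that T' tr by blast
qed

section \<open>Critical tilting and the Gibbs measures\<close>

text \<open>The difference of the two sides is a polynomial whose only negative coefficient is the
  constant one, so it increases strictly from a negative value.\<close>

lemma critical_point_ex1:
  fixes w :: "nat \<Rightarrow> real"
  assumes D: "D \<ge> 2" and w: "\<And>i. w i > 0"
  shows "\<exists>!r. 0 < r \<and> (\<Sum>i\<le>D. w i * r ^ i) = (\<Sum>i\<le>D. real i * w i * r ^ i)"
proof -
  define f where "f r = (\<Sum>i\<le>D. (real i - 1) * w i * r ^ i)" for r
  have f_eq: "(\<Sum>i\<le>D. w i * r ^ i) = (\<Sum>i\<le>D. real i * w i * r ^ i) \<longleftrightarrow> f r = 0" for r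
    by (auto simp: f_def left_diff_distrib sum_subtractf)
  have mono: "f r < f s" if "0 \<le> r" "r < s" for r s
    unfolding f_def
  proof (rule sum_strict_mono_ex1)
    show "\<forall>i\<in>{..D}. (real i - 1) * w i * r ^ i \<le> (real i - 1) * w i * s ^ i"
    proof
      fix i
      show "(real i - 1) * w i * r ^ i \<le> (real i - 1) * w i * s ^ i"
      proof (cases "i = 0")
        case False
        then show ?thesis using that w[of i]
          by (intro mult_left_mono power_mono mult_nonneg_nonneg) auto
      qed simp
    qed
    show "\<exists>i\<in>{..D}. (real i - 1) * w i * r ^ i < (real i - 1) * w i * s ^ i"
      using D that w[of 2] by (intro bexI[of _ 2]) (auto intro!: power_strict_mono)
  qed simp
  \<comment> \<open>At \<open>R\<close> the quadratic term alone outweighs the constant one: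
    \<open>w 0 \<le> w 2 * R\<close>, and \<open>R \<ge> 1\<close>.\<close>
  define R where "R = max 1 (w 0 / w 2)"
  have f0: "f 0 < 0"
  proof -
    have "f 0 = (\<Sum>i\<le>D. if i = 0 then - w 0 else 0)"
      unfolding f_def by (rule sum.cong) auto
    then show ?thesis using w[of 0] by simp
  qed
  have "f R \<ge> 0"
  proof -
    have "w 0 \<le> w 2 * R" using w[of 2] by (simp add: R_def field_simps max_def)
    also have "\<dots> \<le> w 2 * R\<^sup>2"
      using w[of 2] mult_left_mono[of 1 R R] by (simp add: R_def power2_eq_square)
    finally have "0 \<le> - w 0 + w 2 * R\<^sup>2" by simp
    also have "\<dots> = (\<Sum>i\<in>{0, 2}. (real i - 1) * w i * R ^ i)" by simp
    also have "\<dots> \<le> f R"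
      unfolding f_def
    proof (rule sum_mono2)
      fix i assume "i \<in> {..D} - {0, 2}"
      then show "0 \<le> (real i - 1) * w i * R ^ i"
        using w[of i] by (intro mult_nonneg_nonneg) (auto simp: R_def)
    qed (use D in auto)
    finally show ?thesis .
  qed
  moreover have "continuous_on {0..R} f" unfolding f_def by (intro continuous_intros)
  moreover have "0 \<le> R" by (simp add: R_def)
  ultimately obtain r where r: "0 \<le> r" "f r = 0" using IVT'[of f 0 0 R] f0 by auto
  then have "0 < r" using f0 by (cases "r = 0") auto
  moreover have "s = r" if "0 < s" "f s = 0" for s
    using mono[of s r] mono[of r s] that r by (cases s r rule: linorder_cases) auto
  ultimately show ?thesis using r unfolding f_eq by blast
qed

text \<open>A real supremum bounds its members once the set is bounded; the total masses provide the
  bound.\<close>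

lemma total_variation_ge:
  assumes "finite_measure \<mu>" "finite_measure \<nu>" "A \<in> sets \<mu>"
  shows "\<bar>measure \<mu> A - measure \<nu> A\<bar> \<le> total_variation \<mu> \<nu>"
  unfolding total_variation_def
proof (rule cSUP_upper[OF assms(3)])
  have "\<bar>measure \<mu> A - measure \<nu> A\<bar> \<le> measure \<mu> (space \<mu>) + measure \<nu> (space \<nu>)" for A
    using finite_measure.bounded_measure[OF assms(1), of A]
      finite_measure.bounded_measure[OF assms(2), of A] measure_nonneg[of \<mu> A]
      measure_nonneg[of \<nu> A]
    by linarith
  then show "bdd_above ((\<lambda>A. \<bar>measure \<mu> A - measure \<nu> A\<bar>) ` sets \<mu>)"
    by (intro bdd_aboveI2)
qed

section \<open>The critical law and the limits of the Gibbs measures\<close>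

locale gibbs_tree =
  fixes D :: nat and E :: "nat \<Rightarrow> real" and \<beta> :: real
  assumes D_ge_2: "D \<ge> 2"
begin

definition w :: "nat \<Rightarrow> real" where "w i = exp (- \<beta> * E i)"

abbreviation \<rho> :: real where "\<rho> \<equiv> rho D E \<beta>"

definition \<phi> :: real where "\<phi> = (\<Sum>i\<le>D. w i * \<rho> ^ i)"

definition p :: "nat \<Rightarrow> real" where "p i = w i * \<rho> ^ i / \<phi>"

definition \<sigma> :: real where "\<sigma> = \<rho> / \<phi>"

lemma w_pos: "w i > 0"
  by (simp add: w_def)

lemma rho_spec: "\<rho> > 0" "\<phi> = (\<Sum>i\<le>D. real i * w i * \<rho> ^ i)"
proof -
  have "0 < \<rho> \<and> (\<Sum>i\<le>D. w i * \<rho> ^ i) = (\<Sum>i\<le>D. real i * w i * \<rho> ^ i)"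
    unfolding rho_def w_def by (rule theI') (rule critical_point_ex1[OF D_ge_2], simp)
  then show "\<rho> > 0" "\<phi> = (\<Sum>i\<le>D. real i * w i * \<rho> ^ i)" by (auto simp: \<phi>_def)
qed

lemma phi_pos: "\<phi> > 0"
  unfolding \<phi>_def using w_pos rho_spec by (intro sum_pos) auto

lemma sigma_pos: "\<sigma> > 0"
  using phi_pos rho_spec by (simp add: \<sigma>_def)

sublocale critical_offspring D p
proof
  show "p i > 0" for i using w_pos rho_spec phi_pos by (simp add: p_def)
  show "(\<Sum>i\<le>D. p i) = 1"
    using phi_pos by (simp add: p_def \<phi>_def flip: sum_divide_distrib)
  have "(\<Sum>i\<le>D. real i * p i) = (\<Sum>i\<le>D. real i * w i * \<rho> ^ i) / \<phi>"
    by (simp add: p_def sum_divide_distrib mult.assoc)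
  then show "(\<Sum>i\<le>D. real i * p i) = 1" using phi_pos rho_spec by simp
qed (rule D_ge_2)

text \<open>Up to sign, \<open>\<beta> * E i\<close> is \<open>ln (p i)\<close> plus an affine
  function of \<open>i\<close>, whose average the two constraints fix. So \<open>J\<close> is the
  relative entropy with respect to \<open>p\<close> plus \<open>ln \<sigma>\<close>, and its minimum
  is \<open>ln \<sigma>\<close> by Gibbs' inequality.\<close>

lemma sigma_const_eq: "sigma_const D E \<beta> = \<sigma>"
proof -
  have ln_w: "- \<beta> * E i = ln (p i) - real i * ln \<rho> + ln \<phi>" for i
  proof -
    have "ln (p i) = ln (w i) + real i * ln \<rho> - ln \<phi>"
      using w_pos[of i] rho_spec phi_pos by (simp add: p_def ln_div ln_mult ln_realpow)
    then show ?thesis by (simp add: w_def)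
  qed
  have J_eq: "J D E \<beta> q = (\<Sum>i\<le>D. q i * ln (q i) - q i * ln (p i)) + ln \<sigma>"
    if q: "(\<Sum>i\<le>D. q i) = 1" "(\<Sum>i\<le>D. real i * q i) = 1" for q
  proof -
    have "\<beta> * (\<Sum>i\<le>D. q i * E i) = - (\<Sum>i\<le>D. q i * (- \<beta> * E i))"
      by (simp add: sum_distrib_left sum_negf mult_ac)
    also have "\<dots> = - (\<Sum>i\<le>D. q i * ln (p i)) + ln \<rho> * (\<Sum>i\<le>D. real i * q i) - ln \<phi> * (\<Sum>i\<le>D. q i)"
      unfolding ln_w
      by (simp add: sum_distrib_left sum_distrib_right sum.distrib sum_subtractf algebra_simps)
    finally show ?thesis
      using q rho_spec phi_pos by (simp add: J_def \<sigma>_def ln_div sum_subtractf)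
  qed
  \<comment> \<open>Members of \<open>mean_one_laws\<close> are \<open>undefined\<close> outside
    \<open>{..D}\<close>.\<close>
  define p' where "p' = restrict p {..D}"
  have p': "p' \<in> mean_one_laws D"
  proof -
    have "p i \<le> 1" if "i \<le> D" for i
      using member_le_sum[of i "{..D}" p] that p_pos p_sum by (simp add: less_imp_le)
    then show ?thesis
      using p_pos p_sum p_mean by (auto simp: mean_one_laws_def p'_def less_imp_le)
  qed
  have J_p': "J D E \<beta> p' = ln \<sigma>"
    using p_sum p_mean by (subst J_eq) (auto simp: p'_def)
  have J_ge: "J D E \<beta> q \<ge> ln \<sigma>" if q: "q \<in> mean_one_laws D" for q
  proof -
    have "q i * ln (q i) - q i * ln (p i) \<ge> q i - p i" if "i \<le> D" for i
    proof (cases "q i = 0")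
      case False
      then have "q i > 0" using q that by (force simp: mean_one_laws_def PiE_iff)
      then have "ln (p i / q i) \<le> p i / q i - 1" using p_pos[of i] by (intro ln_le_minus_one) simp
      then have "q i * ln (p i / q i) \<le> q i * (p i / q i - 1)" using \<open>q i > 0\<close> by simp
      then show ?thesis
        using \<open>q i > 0\<close> p_pos[of i] by (simp add: ln_div right_diff_distrib)
    qed (use p_pos[of i] in simp)
    then have "(\<Sum>i\<le>D. q i - p i) \<le> (\<Sum>i\<le>D. q i * ln (q i) - q i * ln (p i))"
      by (intro sum_mono) simp
    then show ?thesis
      using J_eq[of q] q p_sum by (simp add: mean_one_laws_def sum_subtractf)
  qed
  define q where "q = arg_min_on (J D E \<beta>) (mean_one_laws D)"
  \<comment> \<open>\<open>arg_min_on\<close> is a choice operator; the minimizer \<open>p'\<close>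
    shows that it returns a minimizer.\<close>
  have "is_arg_min (J D E \<beta>) (\<lambda>x. x \<in> mean_one_laws D) q"
    unfolding q_def arg_min_on_def arg_min_def
    by (rule someI[of _ p']) (use p' J_p' J_ge in \<open>auto simp: is_arg_min_def not_less\<close>)
  then have "J D E \<beta> q = ln \<sigma>"
    using J_ge[of q] J_p' p' by (force simp: is_arg_min_def not_less)
  then show ?thesis using sigma_pos by (simp add: sigma_const_def q_def)
qed

text \<open>\<open>p\<close> is \<open>w\<close> tilted with \<open>a = \<rho>\<close> and
  \<open>b = \<sigma>\<close>. Writing \<open>\<rho> ^ r / \<rho>\<close> keeps the formula valid at
  \<open>r = 0\<close>.\<close>

lemma forest_weight_ratio:
  "forest_weight D w r N / forest_weight D w 1 (N + m) = F r N / F 1 (N + m) * (\<rho> ^ r / \<rho> * \<sigma> ^ m)"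
proof -
  have "p = (\<lambda>i. w i * \<rho> ^ i * \<sigma> / \<rho>)"
    using rho_spec(1) by (auto simp: p_def \<sigma>_def)
  then have "F r k = forest_weight D w r k * \<sigma> ^ k / \<rho> ^ r" for r k
    using forest_weight_tilt[of \<rho> \<sigma> D w r k] rho_spec(1) sigma_pos by simp
  then show ?thesis
    using rho_spec(1) sigma_pos by (simp add: power_add)
qed

lemma exp_tree_energy: "finite T \<Longrightarrow> exp (- \<beta> * tree_energy E T) = (\<Prod>v\<in>T. w (branching T v))"
  by (simp add: tree_energy_def w_def sum_distrib_left flip: exp_sum sum_negf)

text \<open>For \<open>N = 0\<close> there is no tree and the measure is zero, so it is only claimed
  to be finite.\<close>

lemma gibbs_trunc:
  "measure (distr (gibbs D E \<beta> N) (count_space UNIV) (trunc n)) {S} =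
    (\<Sum>T | T \<in> trees_size D N \<and> trunc n T = S. \<Prod>v\<in>T. w (branching T v)) / forest_weight D w 1 N"
  "finite_measure (distr (gibbs D E \<beta> N) (count_space UNIV) (trunc n))"
proof -
  let ?f = "\<lambda>T. exp (- \<beta> * tree_energy E T) / partition_fun D E \<beta> N"
  have Z: "partition_fun D E \<beta> N = forest_weight D w 1 N"
    unfolding partition_fun_def trees_size_weight(2)[symmetric]
    by (rule sum.cong[OF refl]) (rule exp_tree_energy, simp add: trees_size_def)
  have f_nonneg: "?f T \<ge> 0" for T
    unfolding Z using forest_weight_nonneg[of w D 1 N] w_pos by (simp add: less_imp_le)
  have em: "emeasure (gibbs D E \<beta> N) X = ennreal (\<Sum>T\<in>X. ?f T)" if "X \<subseteq> trees_size D N" for X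
    unfolding gibbs_def using that trees_size_weight(1) f_nonneg
    by (subst emeasure_point_measure_finite) (auto simp: sum_ennreal)
  have sp: "space (gibbs D E \<beta> N) = trees_size D N"
    by (simp add: gibbs_def space_point_measure)
  have meas: "trunc n \<in> gibbs D E \<beta> N \<rightarrow>\<^sub>M count_space UNIV"
    by (simp add: gibbs_def)
  have fin: "finite_measure (gibbs D E \<beta> N)"
    by (rule finite_measureI) (simp add: sp em)
  show "finite_measure (distr (gibbs D E \<beta> N) (count_space UNIV) (trunc n))"
    by (rule finite_measure.finite_measure_distr[OF fin meas])
  have "measure (distr (gibbs D E \<beta> N) (count_space UNIV) (trunc n)) {S} =
      measure (gibbs D E \<beta> N) {T \<in> trees_size D N. trunc n T = S}"
    by (subst measure_distr[OF meas]) (auto simp: sp intro!: arg_cong[of _ _ "measure _"])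
  also have "\<dots> = (\<Sum>T | T \<in> trees_size D N \<and> trunc n T = S. ?f T)"
    unfolding measure_def by (subst em) (auto intro!: enn2real_ennreal sum_nonneg simp:
        f_nonneg[simplified])
  also have "\<dots> = (\<Sum>T | T \<in> trees_size D N \<and> trunc n T
      = S. \<Prod>v\<in>T. w (branching T v)) / forest_weight D w 1 N"
    unfolding Z sum_divide_distrib[symmetric]
    by (intro arg_cong2[of _ _ _ _ "(/)"] sum.cong refl exp_tree_energy) (simp add: trees_size_def)
  finally show "measure (distr (gibbs D E \<beta> N) (count_space UNIV) (trunc n)) {S} =
    (\<Sum>T | T \<in> trees_size D N \<and> trunc n T = S. \<Prod>v\<in>T. w (branching T v)) / forest_weight D w 1 N" .
qed

text \<open>Total variation dominates the difference on the singleton \<open>{S}\<close>. The tree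
  size is shifted by the number of vertices below height \<open>n\<close>, so that \<open>N\<close>
  is the size of the forest rooted at level \<open>n\<close>.\<close>

lemma is_P_limit:
  assumes "is_P D E \<beta> n Q" "S \<in> plane_trees D" "\<forall>v\<in>S. length v \<le> n"
  shows "(\<lambda>N. (\<Prod>v | v \<in> S \<and> length v < n. w (branching S v)) *
      (F (card (level_vertices S n)) N / F 1 (N + card {v \<in> S. length v < n}) *
       (\<rho> ^ card (level_vertices S n) / \<rho> * \<sigma> ^ card {v \<in> S. length v < n})))
    \<longlonglongrightarrow> pmf Q S"
proof -
  let ?m = "card {v \<in> S. length v < n}"
  let ?\<mu> = "\<lambda>N. distr (gibbs D E \<beta> N) (count_space UNIV) (trunc n)"
  have "(\<lambda>N. measure (?\<mu> N) {S}) \<longlonglongrightarrow> measure (measure_pmf Q) {S}"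
  proof (rule Lim_null[THEN iffD2], rule tendsto_rabs_zero_cancel, rule tendsto_sandwich[where f
      = "\<lambda>_. 0"])
    show "(\<lambda>N. total_variation (?\<mu> N) (measure_pmf Q)) \<longlonglongrightarrow> 0"
      using assms(1) by (simp add: is_P_def)
    show "\<forall>\<^sub>F N in sequentially. \<bar>measure (?\<mu> N) {S} - measure (measure_pmf Q) {S}\<bar>
        \<le> total_variation (?\<mu> N) (measure_pmf Q)"
      by (intro always_eventually allI total_variation_ge gibbs_trunc(2))
        (auto simp: measure_pmf.finite_measure_axioms)
  qed auto
  then have lim: "(\<lambda>N. measure (?\<mu> (N + ?m)) {S}) \<longlonglongrightarrow> pmf Q S"
    unfolding pmf.rep_eq by (rule LIMSEQ_ignore_initial_segment)
  have S: "finite S"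
    using finite_trunc[OF assms(2), of n] assms(3) by (simp add: trunc_def cong: conj_cong)
  have "measure (?\<mu> (N + ?m)) {S} = (\<Prod>v | v \<in> S \<and> length v < n. w (branching S v)) *
      (F (card (level_vertices S n)) N / F 1 (N + ?m) * (\<rho> ^ card (level_vertices S n) / \<rho>
          * \<sigma> ^ ?m))" for N
    unfolding gibbs_trunc(1) trees_size_trunc_weight(2)[OF assms(2) S assms(3) refl]
      forest_weight_ratio[symmetric] by simp
  then show ?thesis using lim by simp
qed

text \<open>Applied to the star with \<open>i\<close> leaves, which has one vertex below height 1,
  convergence to \<open>Q\<close> gives convergence of the ratio up to a nonzero constant
  factor.\<close>

lemma forest_ratio_limit_of_is_P:
  assumes "is_P D E \<beta> 1 Q"
  shows "(\<lambda>N. F r N / F 1 (N + m)) \<longlonglongrightarrow> real r"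
proof (rule forest_ratio_limit)
  fix i assume i: "1 \<le> i" "i \<le> D"
  define S where "S = graft_star {[]} [] i"
  have S: "S \<in> plane_trees D"
    unfolding S_def using i by (intro graft_star_in_plane_trees) (auto simp: plane_trees_def)
  have "{v. v \<in> S \<and> length v < 1} = {[]}" "level_vertices S 1 = (\<lambda>j. [j]) ` {..<i}"
    "\<forall>v\<in>S. length v \<le> 1"
    by (auto simp: S_def graft_star_def level_vertices_def)
  moreover have "card ((\<lambda>j::nat. [j]) ` {..<i}) = i" by (simp add: card_image inj_on_def)
  ultimately have lim: "(\<lambda>N. w (branching S []) * (F i N / F 1 (N + 1) * (\<rho> ^ i / \<rho> * \<sigma> ^ 1)))
      \<longlonglongrightarrow> pmf Q S"
    using is_P_limit[OF assms S] by simp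
  have "(\<lambda>N. (w (branching S []) * (F i N / F 1 (N + 1) * (\<rho> ^ i / \<rho> * \<sigma> ^ 1))) /
      (w (branching S []) * (\<rho> ^ i / \<rho> * \<sigma> ^ 1))) \<longlonglongrightarrow> pmf Q S / (w (branching S []) * (\<rho> ^ i / \<rho>
          * \<sigma> ^ 1))"
    using w_pos[of "branching S []"] rho_spec(1) sigma_pos
        by (intro tendsto_divide lim tendsto_const) auto
  moreover have "(w (branching S []) * (F i N / F 1 (N + 1) * (\<rho> ^ i / \<rho> * \<sigma> ^ 1))) /
      (w (branching S []) * (\<rho> ^ i / \<rho> * \<sigma> ^ 1)) = F i N / F 1 (Suc N)" for N
    using w_pos[of "branching S []"] rho_spec(1) sigma_pos by simp
  ultimately show "convergent (\<lambda>N. F i N / F 1 (Suc N))" by (auto simp: convergent_def)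
qed

text \<open>For a plane tree this is the size of level \<open>n\<close> times the product of
  \<open>p (branching T v)\<close> over the vertices below it: the law of Kesten's size-biased
  tree.\<close>

definition tree_prob :: "nat \<Rightarrow> nat list set \<Rightarrow> real" where
  "tree_prob n T = (\<Prod>v | v \<in> T \<and> length v < n. w (branching T v)) *
     (real (card (level_vertices T n)) * (\<rho> ^ card (level_vertices T n) / \<rho>)
         * \<sigma> ^ card {v \<in> T. length v < n})"

lemma tree_prob_trunc: "T \<in> plane_trees D \<Longrightarrow> tree_prob n (trunc n T) = tree_prob n T"
proof -
  assume T: "T \<in> plane_trees D"
  have sets: "{v \<in> trunc n T. length v < n} = {v \<in> T. length v < n}" by (auto simp: trunc_def)
  have "(\<Prod>v | v \<in> T \<and> length v < n. w (branching (trunc n T) v))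
      = (\<Prod>v | v \<in> T \<and> length v < n. w (branching T v))"
    by (rule prod.cong) (auto simp: branching_trunc[OF T])
  then show ?thesis unfolding tree_prob_def by (simp add: sets level_vertices_trunc)
qed

text \<open>The test \<open>g' \<in> levels D\<close> makes this the transition probability to an
  arbitrary sequence, as the Markov property ranges over all values.\<close>

definition kernel :: "(nat \<Rightarrow> nat) \<Rightarrow> (nat \<Rightarrow> nat) \<Rightarrow> real" where
  "kernel g g' = (if g' \<in> levels D \<and> g \<lhd>\<^sub>l g'
     then real (level_size g') / real (level_size g) * exp (- \<beta> * level_energy E g g')
       * \<rho> powi (int (level_size g') - int (level_size g)) * \<sigma> ^ level_size g
     else 0)"

lemma tree_prob_Suc:
  assumes T: "T \<in> plane_trees D"
  shows "tree_prob (Suc n) T = tree_prob n T * kernel (level_code n T) (level_code (Suc n) T)"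
proof -
  define r where "r = card (level_vertices T n)"
  define r' where "r' = card (level_vertices T (Suc n))"
  have fin: "finite (level_vertices T n)" "finite {v \<in> T. length v < n}"
    using finite_level[OF T] by (auto intro!: finite_subset[OF _ finite_trunc[OF T, of n]] simp:
        trunc_def)
  have set: "{v \<in> T. length v < Suc n} = {v \<in> T. length v < n} \<union> level_vertices T n"
    by (auto simp: level_vertices_def)
  have disj: "{v \<in> T. length v < n} \<inter> level_vertices T n = {}"
    by (auto simp: level_vertices_def)
  have card: "card {v \<in> T. length v < Suc n} = card {v \<in> T. length v < n} + r"
    unfolding set r_def using fin disj by (intro card_Un_disjoint)
  have "(\<Prod>v\<in>level_vertices T n. w (branching T v))
      = exp (- \<beta> * level_energy E (level_code n T) (level_code (Suc n) T))"
    using fin by (simp add: level_energy_level_code[OF T] w_def sum_distrib_left flip: exp_sum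
        sum_negf)
  then have prod: "(\<Prod>v | v \<in> T \<and> length v < Suc n. w (branching T v)) =
     (\<Prod>v | v \<in> T \<and> length v < n. w (branching T v)) * exp (- \<beta>
         * level_energy E (level_code n T) (level_code (Suc n) T))"
    using fin disj unfolding set by (subst prod.union_disjoint) auto
  have K: "kernel (level_code n T) (level_code (Suc n) T) =
     real r' / real r * exp (- \<beta> * level_energy E (level_code n T) (level_code (Suc n) T))
       * \<rho> powi (int r' - int r) * \<sigma> ^ r"
    by (simp add: kernel_def level_code_in_levels[OF T] level_follows_level_code[OF T]
        level_size_level_code[OF T] r_def r'_def)
  show ?thesis
  proof (cases "r = 0")
    \<comment> \<open>The quotient \<open>real r' / real r\<close> is degenerate here, but an empty
      level has an empty successor and both sides vanish.\<close>
    case True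
    then have "level_vertices T n = {}" using fin by (simp add: r_def)
    then have "r' = 0" by (simp add: r'_def level_Suc[OF T])
    then show ?thesis unfolding K tree_prob_def by (simp add: r'_def)
  next
    case False
    then show ?thesis
      unfolding tree_prob_def prod K card r_def[symmetric] r'_def[symmetric]
      using rho_spec(1) by (simp add: power_int_diff power_add)
  qed
qed

end

section \<open>The limit tree\<close>

locale gibbs_tree_limit = gibbs_tree +
  fixes P :: "nat \<Rightarrow> nat list set pmf" and M :: "nat list set measure"
  assumes P: "\<And>n. n \<ge> 1 \<Longrightarrow> is_P D E \<beta> n (P n)" and M: "is_P_infty D P M"
begin

sublocale prob_space M
  using M by (simp add: is_P_infty_def)

lemma space_M: "space M = plane_trees D"
  using M by (simp add: is_P_infty_def)

text \<open>Truncation takes finitely many values, so preimages are finite unions of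
  generators.\<close>

lemma measurable_trunc: "trunc n \<in> M \<rightarrow>\<^sub>M count_space UNIV"
proof (rule measurableI)
  fix A :: "nat list set set"
  have "{T \<in> plane_trees D. trunc n T = S} \<in> sets M" for S
  proof -
    have "sets M = sigma_sets (plane_trees D) {{T \<in> plane_trees D. trunc n T = S} | n S. True}"
      using M by (auto simp: is_P_infty_def tree_space_def intro!: sets_measure_of)
    then show ?thesis by auto
  qed
  then have "(\<Union>S\<in>trunc n ` plane_trees D \<inter> A. {T \<in> plane_trees D. trunc n T = S}) \<in> sets M"
    using finite_range_trunc by (intro sets.finite_UN) auto
  also have "(\<Union>S\<in>trunc n ` plane_trees D \<inter> A. {T \<in> plane_trees D. trunc n T = S})
      = trunc n -` A \<inter> space M"
    by (auto simp: space_M)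
  finally show "trunc n -` A \<inter> space M \<in> sets M" .
qed simp

lemma measurable_level_code: "level_code n \<in> M \<rightarrow>\<^sub>M count_space UNIV"
proof -
  have "(\<lambda>T. level_code n (trunc n T)) \<in> M \<rightarrow>\<^sub>M count_space UNIV"
    by (rule measurable_compose[OF measurable_trunc]) simp
  then show ?thesis
    by (rule measurable_cong[THEN iffD1, rotated]) (simp add: space_M level_code_trunc)
qed

lemma prob_trunc:
  assumes T: "T \<in> plane_trees D"
  shows "prob {T' \<in> space M. trunc n T' = trunc n T} = tree_prob n T"
proof (cases "n = 0")
  \<comment> \<open>\<open>P\<close> describes only heights \<open>n \<ge> 1\<close>; at height 0
    all trees agree.\<close>
  case True
  have "{T' \<in> space M. trunc n T' = trunc n T} = space M"
    using True root_in_tree T by (auto simp: space_M trunc_def)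
  moreover have "tree_prob n T = 1"
    using True rho_spec(1) by (simp add: tree_prob_def level_0[OF T])
  ultimately show ?thesis by (simp add: prob_space)
next
  case False
  define S where "S = trunc n T"
  have S: "S \<in> plane_trees D" "finite S" "\<forall>v\<in>S. length v \<le> n"
    using trunc_in_plane_trees[OF T] finite_trunc[OF T] by (auto simp: S_def trunc_def)
  have isP: "is_P D E \<beta> n (P n)" using P False by simp
  have "prob {T' \<in> space M. trunc n T' = S} = measure (distr M (count_space UNIV) (trunc n)) {S}"
    by (subst measure_distr[OF measurable_trunc]) (auto intro!: arg_cong[of _ _ prob])
  also have "\<dots> = pmf (P n) S"
    using M False by (simp add: is_P_infty_def pmf.rep_eq)
  also have "\<dots> = tree_prob n S"
  proof -
    \<comment> \<open>The measure at height 1 already gives the ratio limits for all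
      \<open>r\<close> and \<open>m\<close>.\<close>
    have "(\<lambda>N. F r N / F 1 (N + m)) \<longlonglongrightarrow> real r" for r m
      by (rule forest_ratio_limit_of_is_P[OF P]) simp
    then have "(\<lambda>N. (\<Prod>v | v \<in> S \<and> length v < n. w (branching S v)) *
      (F (card (level_vertices S n)) N / F 1 (N + card {v \<in> S. length v < n}) *
       (\<rho> ^ card (level_vertices S n) / \<rho> * \<sigma> ^ card {v \<in> S. length v < n}))) \<longlonglongrightarrow>
      (\<Prod>v | v \<in> S \<and> length v < n. w (branching S v)) *
      (real (card (level_vertices S n)) * (\<rho> ^ card (level_vertices S n) / \<rho>
          * \<sigma> ^ card {v \<in> S. length v < n}))"
      by (intro tendsto_mult tendsto_const)
    then show ?thesis
      unfolding tree_prob_def mult.assoc[of "real _"]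
          by (rule LIMSEQ_unique[OF is_P_limit[OF isP S(1,3)]])
  qed
  finally show ?thesis using tree_prob_trunc[OF T] by (simp add: S_def)
qed

text \<open>If \<open>g\<close> can follow, \<open>level_extension\<close> and
  \<open>trunc_eqI\<close> identify the event with a single truncation at height
  \<open>n + 1\<close>. Otherwise the event is empty and the kernel is zero.\<close>

lemma prob_trunc_level_code:
  assumes T: "T \<in> plane_trees D"
  shows "prob {T' \<in> space M. level_code (Suc n) T' = g \<and> trunc n T' = trunc n T} =
    prob {T' \<in> space M. trunc n T' = trunc n T} * kernel (level_code n T) g"
proof (cases "g \<in> levels D \<and> level_code n T \<lhd>\<^sub>l g")
  case True
  then obtain T' where T': "T' \<in> plane_trees D" "trunc n T' = trunc n T" "level_code (Suc n) T' = g"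
    using level_extension[OF T] by metis
  have code: "level_code k U = level_code k V"
    if "trunc m U = trunc m V" "k \<le> m" "U \<in> plane_trees D" "V \<in> plane_trees D" for k m U V
    using level_code_trunc[OF that(3,2)] level_code_trunc[OF that(4,2)] that(1) by simp
  have "trunc (Suc n) U = trunc (Suc n) T' \<longleftrightarrow> level_code (Suc n) U = g \<and> trunc n U = trunc n T"
    if U: "U \<in> plane_trees D" for U
  proof
    assume eq: "trunc (Suc n) U = trunc (Suc n) T'"
    have "trunc n U = trunc n (trunc (Suc n) U)" "trunc n T' = trunc n (trunc (Suc n) T')"
      by (auto simp: trunc_def)
    then show "level_code (Suc n) U = g \<and> trunc n U = trunc n T"
      using eq T' code[OF eq _ U T'(1), of "Suc n"] by simp
  next
    assume R: "level_code (Suc n) U = g \<and> trunc n U = trunc n T"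
    show "trunc (Suc n) U = trunc (Suc n) T'"
    proof (rule trunc_eqI[OF U T'(1)])
      fix k assume "k \<le> Suc n"
      then show "level_code k U = level_code k T'"
        using R T' code[of n U T' k] U by (cases "k = Suc n") auto
    qed
  qed
  then have "{U \<in> space M. level_code (Suc n) U = g \<and> trunc n U = trunc n T}
     = {U \<in> space M. trunc (Suc n) U = trunc (Suc n) T'}"
    by (auto simp: space_M)
  moreover have "level_code n T' = level_code n T" using code[of n T' T n] T' T by simp
  ultimately show ?thesis
    using prob_trunc[OF T'(1), of "Suc n"] prob_trunc[OF T'(1), of n] tree_prob_Suc[OF T'(1), of
        n] T'
    by simp
next
  case False
  have "\<not> (level_code (Suc n) U = g \<and> trunc n U = trunc n T)" if U: "U \<in> plane_trees D" for U
  proof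
    assume R: "level_code (Suc n) U = g \<and> trunc n U = trunc n T"
    have "level_code n U = level_code n T"
      using level_code_trunc[OF U, of n n] level_code_trunc[OF T, of n n] R by simp
    then show False
      using False R level_code_in_levels[OF U, of n] level_follows_level_code[OF U, of n] by simp
  qed
  then have "{U \<in> space M. level_code (Suc n) U = g \<and> trunc n U = trunc n T} = {}"
    by (auto simp: space_M)
  then have "prob {U \<in> space M. level_code (Suc n) U = g \<and> trunc n U = trunc n T} = 0"
    by (simp only: measure_empty)
  moreover have "kernel (level_code n T) g = 0" unfolding kernel_def by (rule if_not_P[OF False])
  ultimately show ?thesis by simp
qed

text \<open>Sum over the finitely many truncations whose last level is \<open>g\<close>: the kernel
  sees only that level and factors out.\<close>

lemma prob_level_code_Suc:
  "prob {T \<in> space M. level_code (Suc n) T = g' \<and> level_code n T = g} =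
    prob {T \<in> space M. level_code n T = g} * kernel g g'"
proof -
  define \<S> where "\<S> = {S \<in> trunc n ` plane_trees D. level_code n S = g}"
  have fin: "finite \<S>" using finite_range_trunc by (simp add: \<S>_def)
  have [measurable]: "level_code k \<in> M \<rightarrow>\<^sub>M count_space UNIV" "trunc k \<in> M \<rightarrow>\<^sub>M count_space UNIV"
      for k
    by (rule measurable_level_code measurable_trunc)+
  have union: "{T \<in> space M. Q T \<and> level_code n T = g} = (\<Union>S\<in>\<S>. {T \<in> space M. Q T \<and> trunc n T
      = S})" for Q
    using level_code_trunc[of _ D n n] by (force simp: \<S>_def space_M)
  have "prob {T \<in> space M. level_code (Suc n) T = g' \<and> level_code n T = g} =
      (\<Sum>S\<in>\<S>. prob {T \<in> space M. level_code (Suc n) T = g' \<and> trunc n T = S})"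
    unfolding union using fin by (intro finite_measure_finite_Union)
        (auto simp: disjoint_family_on_def)
  also have "\<dots> = (\<Sum>S\<in>\<S>. prob {T \<in> space M. trunc n T = S} * kernel g g')"
    by (rule sum.cong) (auto simp: \<S>_def level_code_trunc prob_trunc_level_code)
  also have "\<dots> = (\<Sum>S\<in>\<S>. prob {T \<in> space M. trunc n T = S}) * kernel g g'"
    by (simp add: sum_distrib_right)
  also have "(\<Sum>S\<in>\<S>. prob {T \<in> space M. trunc n T = S}) = prob (\<Union>S\<in>\<S>. {T \<in> space M. trunc n T = S})"
    using fin by (intro finite_measure_finite_Union[symmetric]) (auto simp: disjoint_family_on_def)
  also have "(\<Union>S\<in>\<S>. {T \<in> space M. trunc n T = S}) = {T \<in> space M. level_code n T = g}"
    using union[of "\<lambda>_. True"] by simp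
  finally show ?thesis .
qed

lemma cond_prob_level_code:
  assumes "\<P>(T in M. level_code n T = g) > 0"
  shows "\<P>(T in M. level_code (Suc n) T = g' \<bar> level_code n T = g) = kernel g g'"
  using assms by (simp add: cond_prob_def prob_level_code_Suc)

text \<open>The codes up to \<open>n\<close> determine the truncation and conversely, so
  conditioning on the history is conditioning on one truncation.\<close>

lemma cond_prob_level_code_history:
  assumes "\<P>(T in M. \<forall>k\<le>n. level_code k T = x k) > 0"
  shows "\<P>(T in M. level_code (Suc n) T = g \<bar> \<forall>k\<le>n. level_code k T = x k) = kernel (x n) g"
proof -
  have "{T \<in> space M. \<forall>k\<le>n. level_code k T = x k} \<noteq> {}" using assms by force
  then obtain T where T: "T \<in> plane_trees D" "\<And>k. k \<le> n \<Longrightarrow> level_code k T = x k"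
    by (auto simp: space_M)
  have iff: "(\<forall>k\<le>n. level_code k U = x k) \<longleftrightarrow> trunc n U = trunc n T" if U: "U \<in> plane_trees D" for U
  proof
    show "\<forall>k\<le>n. level_code k U = x k \<Longrightarrow> trunc n U = trunc n T"
      using T by (intro trunc_eqI[OF U T(1)]) simp
    assume "trunc n U = trunc n T"
    then show "\<forall>k\<le>n. level_code k U = x k"
      using level_code_trunc[OF U] level_code_trunc[OF T(1)] T(2) by metis
  qed
  have "{U \<in> space M. Q U \<and> (\<forall>k\<le>n. level_code k U = x k)} = {U \<in> space M. Q U \<and> trunc n U
      = trunc n T}" for Q
    using iff by (auto simp: space_M)
  from this[of "\<lambda>_. True"] this[of "\<lambda>U. level_code (Suc n) U = g"] show ?thesis
    using assms T by (simp add: cond_prob_def prob_trunc_level_code)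
qed

lemma markov_chain_level_code: "markov_chain M level_code"
  unfolding markov_chain_def
proof (intro conjI allI impI)
  fix n x y
  assume pos: "\<P>(T in M. \<forall>k\<le>n. level_code k T = x k) > 0"
  have "{T \<in> space M. level_code n T = x n} \<in> sets M"
    using measurable_sets[OF measurable_level_code, of "{x n}" n]
        by (simp add: vimage_def Int_def conj_commute)
  \<comment> \<open>The present has positive probability because the history does; both conditional
    probabilities are then the same kernel value.\<close>
  then have "\<P>(T in M. \<forall>k\<le>n. level_code k T = x k) \<le> \<P>(T in M. level_code n T = x n)"
    by (intro finite_measure_mono) auto
  then show "\<P>(T in M. level_code (Suc n) T = y \<bar> \<forall>k\<le>n. level_code k T = x k) =
      \<P>(T in M. level_code (Suc n) T = y \<bar> level_code n T = x n)"
    using cond_prob_level_code_history[OF pos] cond_prob_level_code[of n "x n" y] pos by simp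
qed (rule measurable_level_code)

end

theorem theorem7:
  fixes D :: nat and E :: "nat \<Rightarrow> real" and \<beta> :: real
    and P :: "nat \<Rightarrow> nat list set pmf" and P_infty :: "nat list set measure"
  assumes "D \<ge> 2"
    and "\<And>n. n \<ge> 1 \<Longrightarrow> is_P D E \<beta> n (P n)"
    and "is_P_infty D P P_infty"
  shows "markov_chain P_infty level_code \<and>
    (\<forall>n. \<forall>g\<in>levels D. \<forall>g'\<in>levels D.
       \<P>(T in P_infty. level_code n T = g) > 0 \<longrightarrow>
       \<P>(T in P_infty. level_code (Suc n) T = g' \<bar> level_code n T = g) =
         (if g \<lhd>\<^sub>l g'
          then real (level_size g') / real (level_size g) * exp (- \<beta> * level_energy E g g')
                 * rho D E \<beta> powi (int (level_size g') - int (level_size g))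
                 * sigma_const D E \<beta> ^ level_size g
          else 0))"
proof -
  interpret gibbs_tree_limit D E \<beta> P P_infty
    using assms by unfold_locales auto
  show ?thesis
    using markov_chain_level_code cond_prob_level_code
    by (simp add: kernel_def sigma_const_eq)
qed

end
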